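(* Let $a,b>0$ and let $K$ be either the Gaussian kernel $K(t)=ae^{-bt^2/2}$ or the Ornstein–Uhlenbeck kernel $K(t)=ae^{-b|t|}$. Let $\omega>0$ be fixed and known, let $\Xi\subset\mathbb{R}^2$ be an open bounded convex set, let $\xi_0\in\Xi$, and consider the drift family $\mu_\xi(t)=\xi_1\sin(\omega t)+\xi_2\cos(\omega t)$, $\xi=(\xi_1,\xi_2)^\top$. Let $h_n\to0$, $T_n=nh_n\to\infty$ and $T_nh_n\to0$. Then the estimator $\widehat{\xi}_n$ defined in the context satisfies, as $n\to\infty$, $$\sqrt{T_n}\,(\widehat{\xi}_n-\xi_0)\ \xrightarrow{\ d\ }\ \mathcal{N}\bigl(0,\;4\omega^2C_K(\omega)\,\mathrm{Id}_2\bigr),\qquad C_K(\omega):=\int_0^\infty K(u)\cos(\omega u)\,du,$$ where $C_K(\omega)=\dfrac{ab}{b^2+\omega^2}$ for the Ornstein–Uhlenbeck kernel and $C_K(\omega)=a\sqrt{\dfrac{\pi}{2b}}\,e^{-\omega^2/(2b)}$ for the Gaussian kernel.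
   Context: $Z=(Z_t)_{t\ge0}$ is a centered stationary Gaussian process with covariance $\mathbb{E}[Z_tZ_s]=K(|t-s|)$. For the true parameter $\xi_0\in\Xi$ the observed process is $X_t=Z_t+\int_0^t\mu_{\xi_0}(s)\,ds$, $t\ge0$. For each $n$, $X$ is observed at $t_i=ih_n$, $i=0,1,\dots,n$, with $h_n>0$, and $\Delta_i^nX=X_{t_i}-X_{t_{i-1}}$. The contrast function is $$H_n(\xi)=\sum_{i=1}^n\bigl(\Delta_i^nX-\mu_\xi(t_{i-1})h_n\bigr)^2,$$ and the estimator is any (measurable) minimizer $\widehat{\xi}_n\in\arg\min_{\xi\in\overline{\Xi}}H_n(\xi)$, where $\overline{\Xi}$ is the closure of $\Xi$. $\mathrm{Id}_2$ is the $2\times2$ identity matrix and $\xrightarrow{d}$ denotes convergence in distribution. *)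

theory Defs
  imports "HOL-Probability.Probability"
begin

text \<open>One-dimensional normal law; zero variance is allowed (Dirac mass), since linear combinations
  of jointly Gaussian variables may be degenerate.\<close>

definition normal_law :: "real \<Rightarrow> real \<Rightarrow> real measure" where
  "normal_law m v = (if v = 0 then return borel m else density lborel (normal_density m (sqrt v)))"

definition gaussian_process :: "'w measure \<Rightarrow> real set \<Rightarrow> (real \<Rightarrow> 'w \<Rightarrow> real) \<Rightarrow> bool" where
  "gaussian_process M I Z \<longleftrightarrow>
     (\<forall>t\<in>I. Z t \<in> borel_measurable M) \<and>
     (\<forall>J c. finite J \<and> J \<subseteq> I \<longrightarrow>
        (\<exists>m v. v \<ge> 0 \<and> distr M borel (\<lambda>w. \<Sum>t\<in>J. c t * Z t w) = normal_law m v))"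

text \<open>For a centered Gaussian process, stationarity is the fact that the covariance depends on
  \<open>\<bar>t - s\<bar>\<close> only.\<close>

definition centered_stationary_gaussian_process ::
    "'w measure \<Rightarrow> (real \<Rightarrow> real) \<Rightarrow> (real \<Rightarrow> 'w \<Rightarrow> real) \<Rightarrow> bool" where
  "centered_stationary_gaussian_process M K Z \<longleftrightarrow>
     gaussian_process M {0..} Z \<and>
     (\<forall>t\<ge>0. (\<integral>w. Z t w \<partial>M) = 0) \<and>
     (\<forall>t\<ge>0. \<forall>s\<ge>0. (\<integral>w. Z t w * Z s w \<partial>M) = K \<bar>t - s\<bar>)"

definition gaussian_kernel :: "real \<Rightarrow> real \<Rightarrow> real \<Rightarrow> real" where
  "gaussian_kernel a b t = a * exp (- b * t\<^sup>2 / 2)"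

definition ou_kernel :: "real \<Rightarrow> real \<Rightarrow> real \<Rightarrow> real" where
  "ou_kernel a b t = a * exp (- b * \<bar>t\<bar>)"

definition cos_transform :: "(real \<Rightarrow> real) \<Rightarrow> real \<Rightarrow> real" where
  "cos_transform K \<omega> = (LBINT u:{0..}. K u * cos (\<omega> * u))"

definition periodic_drift :: "real \<Rightarrow> real ^ 2 \<Rightarrow> real \<Rightarrow> real" where
  "periodic_drift \<omega> \<xi> t = \<xi> $ 1 * sin (\<omega> * t) + \<xi> $ 2 * cos (\<omega> * t)"

definition observed_process ::
    "('p \<Rightarrow> real \<Rightarrow> real) \<Rightarrow> 'p \<Rightarrow> (real \<Rightarrow> 'w \<Rightarrow> real) \<Rightarrow> real \<Rightarrow> 'w \<Rightarrow> real" where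
  "observed_process \<mu> \<xi>0 Z t w = Z t w + (LBINT s:{0..t}. \<mu> \<xi>0 s)"

definition contrast ::
    "('p \<Rightarrow> real \<Rightarrow> real) \<Rightarrow> nat \<Rightarrow> real \<Rightarrow> (real \<Rightarrow> real) \<Rightarrow> 'p \<Rightarrow> real" where
  "contrast \<mu> n h x \<xi> =
     (\<Sum>i=1..n. (x (real i * h) - x (real (i - 1) * h) - \<mu> \<xi> (real (i - 1) * h) * h)\<^sup>2)"

text \<open>Normal law on \<open>\<real>\<^sup>n\<close>, given by its density; meaningful for positive definite \<open>\<Sigma>\<close> only.\<close>

definition multivariate_normal :: "real ^ 'n \<Rightarrow> real ^ 'n ^ 'n \<Rightarrow> (real ^ 'n) measure" where
  "multivariate_normal m \<Sigma> = density lborel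
     (\<lambda>x. ennreal (exp (- ((x - m) \<bullet> (matrix_inv \<Sigma> *v (x - m))) / 2)
                    / sqrt ((2 * pi) ^ CARD('n) * det \<Sigma>)))"

text \<open>The library's \<open>weak_conv_m\<close> covers measures on the real line only.\<close>

definition converges_in_distribution ::
    "'w measure \<Rightarrow> (nat \<Rightarrow> 'w \<Rightarrow> 'a::topological_space) \<Rightarrow> 'a measure \<Rightarrow> bool" where
  "converges_in_distribution M Y \<nu> \<longleftrightarrow>
     (\<forall>f :: 'a \<Rightarrow> real. continuous_on UNIV f \<and> bounded (range f) \<longrightarrow>
        (\<lambda>n. \<integral>x. f x \<partial>distr M borel (Y n)) \<longlonglongrightarrow> (\<integral>x. f x \<partial>\<nu>))"

end

theory Submission
  imports Defs
begin

text \<open>The drift is linear in the parameter, so the contrast is a quadratic function whose Hessian,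
  after normalization, is the design matrix. With \<open>T = n * h n\<close> and \<open>g t = (sin (\<omega> * t), cos (\<omega> * t))\<close>,
  that matrix is \<open>T / 2\<close> times the identity up to a bounded error (\<open>design_quadratic_form\<close>), because the
  sums of the oscillating parts of \<open>sin\<^sup>2\<close>, \<open>cos\<^sup>2\<close> and \<open>sin * cos\<close> are of order \<open>1 / h n\<close>. Hence
  the minimizer is close to \<open>\<xi>0 + \<eta>\<close>, where \<open>\<eta>\<close> is \<open>2 / T\<close> times the score
  \<open>\<Sum>i. g (t (i - 1)) * (increment of X - drift * h)\<close>, as soon as \<open>\<xi>0 + \<eta>\<close> belongs to the parameter set
  (\<open>minimizer_close_to_scaled_score\<close>). This happens with probability tending to \<open>1\<close>, since \<open>\<xi>0\<close> is an
  interior point and \<open>\<eta>\<close> tends to \<open>0\<close>.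

  Summation by parts in the score moves the differences from \<open>Z\<close> to \<open>g\<close>, so that \<open>sqrt T *\<^sub>R \<eta>\<close> equals
  \<open>- 2 * h n / sqrt T\<close> times \<open>\<Sum>i. Z (t i) *\<^sub>R g' (t i)\<close> up to boundary terms of order \<open>1 / sqrt T\<close> and
  discretization errors of order \<open>sqrt T * h n\<close>, which vanish because \<open>T * h n\<close> does
  (\<open>score_observed_process\<close>, \<open>expectation_remainder_bound_le\<close>).

  The projection of this sum onto any vector \<open>s\<close> is exactly normal, so only its variance has to be
  followed. A projection of \<open>g'\<close> is \<open>\<omega> * norm s\<close> times a cosine with a phase, and the double sum of
  \<open>cos * cos * K\<close>, ordered by the lag of the two observation times, is a Riemann sum of
  \<open>K u * cos (\<omega> * u)\<close> plus an oscillating part that averages out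
  (\<open>quadratic_form_of_sampled_cosine_tendsto\<close>). The variance tends to \<open>4 * \<omega>\<^sup>2 * C * (norm s)\<^sup>2\<close> with
  \<open>C = cos_transform K \<omega>\<close>, which is the variance of the asserted limit in direction \<open>s\<close>.

  Convergence of the characteristic functions in the plane gives convergence in distribution
  (\<open>converges_in_distribution_if_characteristic_functions_converge\<close>). By tightness, a bounded continuous
  function may be replaced by a continuous function of the sines of small multiples of the coordinates;
  by the Stone--Weierstrass theorem this is a uniform limit of polynomials in these sines, that is, of
  trigonometric polynomials.\<close>

section \<open>Weak convergence on Euclidean spaces\<close>

text \<open>A bounded continuous function is turned into a function of finitely many sines: composing it with
  the coordinatewise triangle wave \<open>arcsine_map \<theta> \<circ> sine_map \<theta>\<close> changes neither its bound nor its values on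
  a ball of radius \<open>pi / (2 * \<theta>)\<close>, and makes it a continuous function of points of the cube
  \<open>cbox (- One) One\<close>, where polynomials are dense.\<close>

definition sine_map :: "real \<Rightarrow> 'a::euclidean_space \<Rightarrow> 'a" where
  "sine_map \<theta> x = (\<Sum>b\<in>Basis. sin (\<theta> * (b \<bullet> x)) *\<^sub>R b)"

definition arcsine_map :: "real \<Rightarrow> 'a::euclidean_space \<Rightarrow> 'a" where
  "arcsine_map \<theta> y = (\<Sum>b\<in>Basis. (arcsin (b \<bullet> y) / \<theta>) *\<^sub>R b)"

lemma sine_map_mem: "sine_map \<theta> x \<in> cbox (- One) One"
  by (auto simp: mem_box sine_map_def inner_sum_left inner_Basis if_distrib sum.delta cong: if_cong)

lemma arcsine_map_sine_map:
  assumes "\<theta> > 0" "norm x \<le> pi / (2 * \<theta>)"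
  shows "arcsine_map \<theta> (sine_map \<theta> x) = x"
proof (rule euclidean_eqI)
  fix b :: 'a assume b: "b \<in> Basis"
  have "\<bar>b \<bullet> x\<bar> \<le> pi / (2 * \<theta>)"
    using Basis_le_norm[OF b, of x] assms(2) by (simp add: inner_commute)
  then have "\<bar>\<theta> * (b \<bullet> x)\<bar> \<le> pi / 2"
    using assms(1) by (simp add: abs_mult field_simps)
  then have "arcsin (sin (\<theta> * (b \<bullet> x))) = \<theta> * (b \<bullet> x)"
    by (intro arcsin_sin) auto
  moreover have "b \<bullet> sine_map \<theta> x = sin (\<theta> * (b \<bullet> x))"
    using b by (simp add: sine_map_def inner_sum_right inner_Basis if_distrib sum.delta cong: if_cong)
  ultimately show "arcsine_map \<theta> (sine_map \<theta> x) \<bullet> b = x \<bullet> b"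
    using b assms(1)
    by (simp add: arcsine_map_def inner_sum_left inner_Basis if_distrib sum.delta inner_commute[of b x] cong: if_cong)
qed

lemma continuous_on_arcsine_map:
  assumes "\<theta> > 0" shows "continuous_on (cbox (- One) One) (arcsine_map \<theta>)"
  unfolding arcsine_map_def
proof -
  have "- 1 \<le> b \<bullet> y \<and> b \<bullet> y \<le> 1" if "b \<in> Basis" "y \<in> cbox (- One) One" for b y :: 'a
  proof -
    have "One \<bullet> b = 1" using that(1) by (simp add: inner_sum_left inner_Basis)
    then show ?thesis using that by (auto simp: mem_box inner_commute[of b y])
  qed
  then show "continuous_on (cbox (- One) One) (\<lambda>y. \<Sum>b\<in>Basis. (arcsin (b \<bullet> y) / \<theta>) *\<^sub>R b :: 'a)"
    using assms by (intro continuous_intros) auto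
qed

lemma continuous_sine_map: "continuous_on A (sine_map \<theta>)"
  unfolding sine_map_def by (intro continuous_intros)

lemma expectation_diff_le_prob:
  fixes f g :: "'a::euclidean_space \<Rightarrow> real"
  assumes "prob_space M" and Y: "Y \<in> borel_measurable M"
    and [measurable]: "f \<in> borel_measurable borel" "g \<in> borel_measurable borel"
    and B: "\<And>x. \<bar>f x\<bar> \<le> B" "\<And>x. \<bar>g x\<bar> \<le> B" and eq: "\<And>x. norm x \<le> R \<Longrightarrow> f x = g x"
  shows "\<bar>(\<integral>w. f (Y w) \<partial>M) - (\<integral>w. g (Y w) \<partial>M)\<bar> \<le> 2 * B * measure M {w\<in>space M. norm (Y w) > R}"
proof -
  interpret prob_space M by fact
  note Y[measurable]
  have i: "integrable M (\<lambda>w. f (Y w))" "integrable M (\<lambda>w. g (Y w))"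
    by (rule integrable_const_bound[where B=B], use B in auto)+
  have "\<bar>\<integral>w. f (Y w) - g (Y w) \<partial>M\<bar> \<le> (\<integral>w. \<bar>f (Y w) - g (Y w)\<bar> \<partial>M)"
    by (rule integral_abs_bound)
  also have "\<dots> \<le> (\<integral>w. 2 * B * indicator {w\<in>space M. norm (Y w) > R} w \<partial>M)"
  proof (rule integral_mono)
    show "integrable M (\<lambda>w. \<bar>f (Y w) - g (Y w)\<bar>)" using i by auto
    show "integrable M (\<lambda>w. 2 * B * indicator {w\<in>space M. norm (Y w) > R} w)"
      by (intro integrable_mult_right integrable_real_indicator) (auto simp: emeasure_eq_measure)
    show "\<bar>f (Y w) - g (Y w)\<bar> \<le> 2 * B * indicator {w\<in>space M. norm (Y w) > R} w" if "w \<in> space M" for w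
      using that eq[of "Y w"] B[of "Y w"] by (auto simp: indicator_def abs_le_iff)
  qed
  also have "\<dots> = 2 * B * measure M {w\<in>space M. norm (Y w) > R}" by simp
  finally show ?thesis using i by simp
qed

text \<open>The characteristic functions of \<open>Y n\<close> converge to that of \<open>\<nu>\<close> exactly if the constant \<open>1\<close> belongs to
  the class below. Carrying a free frequency \<open>s\<close> along makes the class invariant under multiplication by
  \<open>\<lambda>x. iexp (t \<bullet> x)\<close>, which merely shifts \<open>s\<close>.\<close>

definition iexp_limit_class ::
    "'w measure \<Rightarrow> (nat \<Rightarrow> 'w \<Rightarrow> 'a::euclidean_space) \<Rightarrow> 'a measure \<Rightarrow> ('a \<Rightarrow> complex) set" where
  "iexp_limit_class M Y \<nu> = {u. u \<in> borel_measurable borel \<and> bounded (range u) \<and>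
     (\<forall>s. (\<lambda>n. \<integral>w. u (Y n w) * iexp (s \<bullet> Y n w) \<partial>M) \<longlonglongrightarrow> (\<integral>x. u x * iexp (s \<bullet> x) \<partial>\<nu>))}"

text \<open>The class itself is not visibly closed under products, but the functions that multiply it into
  itself trivially are. They contain the constants and the sines, hence all polynomials in sines.\<close>

definition multiplier :: "('a \<Rightarrow> complex) set \<Rightarrow> ('a \<Rightarrow> real) \<Rightarrow> bool" where
  "multiplier C g \<longleftrightarrow> (\<forall>u\<in>C. (\<lambda>x. of_real (g x) * u x) \<in> C)"

lemma integrable_bounded_random_variable:
  fixes u :: "'a::euclidean_space \<Rightarrow> 'b::{banach, second_countable_topology}"
  assumes "prob_space M" "Y \<in> borel_measurable M" "u \<in> borel_measurable borel" "bounded (range u)"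
  shows "integrable M (\<lambda>w. u (Y w))"
proof -
  interpret prob_space M by fact
  obtain B where B: "\<And>x. norm (u x) \<le> B" using assms(4) by (auto simp: bounded_iff)
  show ?thesis
    by (rule integrable_const_bound[where B=B]) (use assms B in auto)
qed

context
  fixes M :: "'w measure" and Y :: "nat \<Rightarrow> 'w \<Rightarrow> 'a::euclidean_space" and \<nu> :: "'a measure"
  assumes M: "prob_space M" and Y: "\<And>n. Y n \<in> borel_measurable M"
    and N: "prob_space \<nu>" and sets: "sets \<nu> = sets borel"
begin

lemma iexp_limit_class_integrable:
  assumes u: "u \<in> iexp_limit_class M Y \<nu>"
  shows "integrable M (\<lambda>w. u (Y n w) * iexp (s \<bullet> Y n w))"
    and "integrable \<nu> (\<lambda>x. u x * iexp (s \<bullet> x))"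
proof -
  have m[measurable]: "u \<in> borel_measurable borel" and "bounded (range u)"
    using u by (auto simp: iexp_limit_class_def)
  then have b: "bounded (range (\<lambda>x. u x * iexp (s \<bullet> x)))"
    by (auto simp: bounded_iff norm_mult)
  show "integrable M (\<lambda>w. u (Y n w) * iexp (s \<bullet> Y n w))"
    by (rule integrable_bounded_random_variable[OF M Y _ b]) measurable
  have "(\<lambda>x. x) \<in> borel_measurable \<nu>" by (rule measurable_ident_sets[OF sets])
  then show "integrable \<nu> (\<lambda>x. u x * iexp (s \<bullet> x))"
    by (rule integrable_bounded_random_variable[OF N _ _ b]) measurable
qed

lemma iexp_limit_class_add:
  assumes u: "u \<in> iexp_limit_class M Y \<nu>" and v: "v \<in> iexp_limit_class M Y \<nu>"
  shows "(\<lambda>x. u x + v x) \<in> iexp_limit_class M Y \<nu>"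
proof -
  note int = iexp_limit_class_integrable
  have "(\<lambda>n. \<integral>w. (u (Y n w) + v (Y n w)) * iexp (s \<bullet> Y n w) \<partial>M) \<longlonglongrightarrow> 
           (\<integral>x. (u x + v x) * iexp (s \<bullet> x) \<partial>\<nu>)" for s
    unfolding ring_distribs int(1)[OF u, THEN Bochner_Integration.integral_add, OF int(1)[OF v]]
        int(2)[OF u, THEN Bochner_Integration.integral_add, OF int(2)[OF v]]
    using u v by (intro tendsto_add) (auto simp: iexp_limit_class_def)
  moreover have "bounded (range (\<lambda>x. u x + v x))"
    using u v by (auto simp: iexp_limit_class_def intro!: bounded_plus_comp)
  ultimately show ?thesis using u v by (auto simp: iexp_limit_class_def)
qed

lemma iexp_limit_class_mult_const:
  assumes u: "u \<in> iexp_limit_class M Y \<nu>"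
  shows "(\<lambda>x. c * u x) \<in> iexp_limit_class M Y \<nu>"
proof -
  obtain B where B: "\<And>x. norm (u x) \<le> B"
    using u by (auto simp: iexp_limit_class_def bounded_iff)
  have "bounded (range (\<lambda>x. c * u x))"
    using mult_left_mono[OF B norm_ge_zero[of c]] by (auto simp: bounded_iff norm_mult)
  moreover have "(\<lambda>n. \<integral>w. c * u (Y n w) * iexp (s \<bullet> Y n w) \<partial>M) \<longlonglongrightarrow> 
           (\<integral>x. c * u x * iexp (s \<bullet> x) \<partial>\<nu>)" for s
    using u by (auto simp: iexp_limit_class_def mult.assoc intro!: tendsto_mult_left)
  ultimately show ?thesis using u by (auto simp: iexp_limit_class_def)
qed

lemma iexp_limit_class_mult_iexp:
  assumes u: "u \<in> iexp_limit_class M Y \<nu>"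
  shows "(\<lambda>x. iexp (t \<bullet> x) * u x) \<in> iexp_limit_class M Y \<nu>"
proof -
  have [measurable]: "u \<in> borel_measurable borel" using u by (auto simp: iexp_limit_class_def)
  have "bounded (range (\<lambda>x. iexp (t \<bullet> x) * u x))"
    using u unfolding iexp_limit_class_def bounded_iff by (auto simp: norm_mult)
  moreover have eq: "iexp (t \<bullet> x) * u x * iexp (s \<bullet> x) = u x * iexp ((t + s) \<bullet> x)" for s x
    by (simp add: inner_add_left exp_add ring_distribs)
  moreover have "(\<lambda>n. \<integral>w. iexp (t \<bullet> Y n w) * u (Y n w) * iexp (s \<bullet> Y n w) \<partial>M) \<longlonglongrightarrow> 
           (\<integral>x. iexp (t \<bullet> x) * u x * iexp (s \<bullet> x) \<partial>\<nu>)" for s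
    unfolding eq using u by (auto simp: iexp_limit_class_def)
  ultimately show ?thesis by (auto simp: iexp_limit_class_def)
qed

lemma multiplier_add:
  assumes "multiplier (iexp_limit_class M Y \<nu>) f" "multiplier (iexp_limit_class M Y \<nu>) g"
  shows "multiplier (iexp_limit_class M Y \<nu>) (\<lambda>x. f x + g x)"
  using assms iexp_limit_class_add
  unfolding multiplier_def by (auto simp: ring_distribs)

lemma multiplier_const: "multiplier (iexp_limit_class M Y \<nu>) (\<lambda>x. c)"
  unfolding multiplier_def by (auto intro: iexp_limit_class_mult_const)

lemma multiplier_mult:
  assumes "multiplier C f" "multiplier C g"
  shows "multiplier C (\<lambda>x. f x * g x)"
  using assms unfolding multiplier_def by (auto simp: mult.assoc)

lemma multiplier_sin:
  "multiplier (iexp_limit_class M Y \<nu>) (\<lambda>x. sin (t \<bullet> x))"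
  unfolding multiplier_def
proof
  fix u assume u: "u \<in> iexp_limit_class M Y \<nu>"
  have eq: "complex_of_real (sin y) = (- \<i> / 2) * iexp y + (\<i> / 2) * iexp (- y)" for y
    by (simp add: complex_eq_iff Re_exp Im_exp)
  have "(\<lambda>x. (- \<i> / 2) * (iexp (t \<bullet> x) * u x) + (\<i> / 2) * (iexp ((- t) \<bullet> x) * u x)) \<in> iexp_limit_class M Y \<nu>"
    by (intro iexp_limit_class_add iexp_limit_class_mult_const iexp_limit_class_mult_iexp u)
  then show "(\<lambda>x. complex_of_real (sin (t \<bullet> x)) * u x) \<in> iexp_limit_class M Y \<nu>"
    unfolding eq by (simp add: ring_distribs mult.assoc)
qed

lemma polynomial_of_sines_converges:
  assumes char: "\<And>s. (\<lambda>n. \<integral>w. iexp (s \<bullet> Y n w) \<partial>M) \<longlonglongrightarrow> (\<integral>x. iexp (s \<bullet> x) \<partial>\<nu>)"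
    and p: "real_polynomial_function p"
  shows "(\<lambda>n. \<integral>w. p (sine_map \<theta> (Y n w)) \<partial>M) \<longlonglongrightarrow> (\<integral>x. p (sine_map \<theta> x) \<partial>\<nu>)"
proof -
  let ?C = "iexp_limit_class M Y \<nu>"
  have "multiplier ?C (\<lambda>x. p (sine_map \<theta> x))"
    using p
  proof induction
    case (linear f)
    have "f (sine_map \<theta> x) = (\<Sum>b\<in>Basis. sin ((\<theta> *\<^sub>R b) \<bullet> x) * f b)" for x
      using linear by (simp add: sine_map_def linear_sum bounded_linear.linear linear_cmul)
    moreover have "multiplier ?C (\<lambda>x. \<Sum>b\<in>B. sin ((\<theta> *\<^sub>R b) \<bullet> x) * f b)" if "finite B" for B
      using that
    proof induction
      case (insert b B)
      then show ?case
        by (simp del: inner_scaleR_left) (intro multiplier_add multiplier_mult multiplier_sin multiplier_const)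
    qed (simp add: multiplier_const)
    ultimately show ?case by simp
  qed (auto intro!: multiplier_const multiplier_add multiplier_mult)
  moreover have "(\<lambda>x. 1) \<in> ?C" using char by (auto simp: iexp_limit_class_def)
  ultimately have "(\<lambda>x. complex_of_real (p (sine_map \<theta> x)) * 1) \<in> ?C"
    unfolding multiplier_def by (rule bspec)
  then have "(\<lambda>n. \<integral>w. complex_of_real (p (sine_map \<theta> (Y n w))) * iexp (0 \<bullet> Y n w) \<partial>M) \<longlonglongrightarrow> 
      (\<integral>x. complex_of_real (p (sine_map \<theta> x)) * iexp (0 \<bullet> x) \<partial>\<nu>)"
    unfolding iexp_limit_class_def by (simp del: inner_zero_left)
  then show ?thesis by (simp add: tendsto_of_real_iff)
qed

lemma continuous_of_sines_converges:
  fixes F :: "'a::euclidean_space \<Rightarrow> real"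
  assumes char: "\<And>s. (\<lambda>n. \<integral>w. iexp (s \<bullet> Y n w) \<partial>M) \<longlonglongrightarrow> (\<integral>x. iexp (s \<bullet> x) \<partial>\<nu>)"
    and F: "continuous_on (cbox (- One) One) F"
  shows "(\<lambda>n. \<integral>w. F (sine_map \<theta> (Y n w)) \<partial>M) \<longlonglongrightarrow> (\<integral>x. F (sine_map \<theta> x) \<partial>\<nu>)"
proof (rule LIMSEQ_I)
  fix r :: real assume r: "r > 0"
  interpret M: prob_space M by (rule M)
  interpret N: prob_space \<nu> by (rule N)
  obtain p where p: "real_polynomial_function p" and 
    close: "\<And>x. x \<in> cbox (- One) One \<Longrightarrow> \<bar>F x - p x\<bar> < r / 3"
    using Stone_Weierstrass_real_polynomial_function[OF compact_cbox F] r by (metis zero_less_divide_iff zero_less_numeral)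
  have [measurable]: "sine_map \<theta> \<in> borel_measurable (borel :: 'a measure)"
    by (intro borel_measurable_continuous_onI continuous_sine_map)
  have idm: "(\<lambda>x. x) \<in> borel_measurable \<nu>" by (rule measurable_ident_sets[OF sets])
  have aux: "continuous_on (cbox (- One) One) G \<Longrightarrow> 
      (\<lambda>x. G (sine_map \<theta> x)) \<in> borel_measurable borel \<and> bounded (range (\<lambda>x. G (sine_map \<theta> x)))"
    for G :: "'a \<Rightarrow> real"
  proof
    assume G: "continuous_on (cbox (- One) One) G"
    show "(\<lambda>x. G (sine_map \<theta> x)) \<in> borel_measurable borel"
      by (intro borel_measurable_continuous_onI continuous_on_compose2[OF G continuous_sine_map])
        (use sine_map_mem in auto)
    have "bounded (G ` cbox (- One) One)"
      using G compact_cbox compact_continuous_image compact_imp_bounded by blast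
    then show "bounded (range (\<lambda>x. G (sine_map \<theta> x)))"
      by (rule bounded_subset) (use sine_map_mem in auto)
  qed
  have cp: "continuous_on (cbox (- One) One) p"
    using p by (simp add: continuous_on_polymonial_function real_polynomial_function_eq)
  note auxF = aux[OF F] and auxp = aux[OF cp]
  have iM: "integrable M (\<lambda>w. F (sine_map \<theta> (Y n w)))" "integrable M (\<lambda>w. p (sine_map \<theta> (Y n w)))" for n
    using integrable_bounded_random_variable[OF M Y] auxF auxp by blast+
  have iN: "integrable \<nu> (\<lambda>w. F (sine_map \<theta> w))" "integrable \<nu> (\<lambda>w. p (sine_map \<theta> w))"
    using integrable_bounded_random_variable[OF N idm] auxF auxp by blast+
  have cl: "F (sine_map \<theta> x) - p (sine_map \<theta> x) \<le> r / 3" "p (sine_map \<theta> x) - F (sine_map \<theta> x) \<le> r / 3" for x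
    using close[OF sine_map_mem[of \<theta> x]] unfolding abs_less_iff by linarith+
  have dM: "\<bar>(\<integral>w. F (sine_map \<theta> (Y n w)) \<partial>M) - (\<integral>w. p (sine_map \<theta> (Y n w)) \<partial>M)\<bar> \<le> r / 3" for n
  proof -
    have "(\<integral>w. F (sine_map \<theta> (Y n w)) - p (sine_map \<theta> (Y n w)) \<partial>M) \<le> r / 3"
      by (intro M.integral_le_const) (use iM cl in auto)
    moreover have "(\<integral>w. p (sine_map \<theta> (Y n w)) - F (sine_map \<theta> (Y n w)) \<partial>M) \<le> r / 3"
      by (intro M.integral_le_const) (use iM cl in auto)
    ultimately show ?thesis
      unfolding Bochner_Integration.integral_diff[OF iM] Bochner_Integration.integral_diff[OF iM(2,1)] by linarith
  qed
  have dN: "\<bar>(\<integral>w. F (sine_map \<theta> w) \<partial>\<nu>) - (\<integral>w. p (sine_map \<theta> w) \<partial>\<nu>)\<bar> \<le> r / 3"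
  proof -
    have "(\<integral>w. F (sine_map \<theta> w) - p (sine_map \<theta> w) \<partial>\<nu>) \<le> r / 3"
      by (intro N.integral_le_const) (use iN cl in auto)
    moreover have "(\<integral>w. p (sine_map \<theta> w) - F (sine_map \<theta> w) \<partial>\<nu>) \<le> r / 3"
      by (intro N.integral_le_const) (use iN cl in auto)
    ultimately show ?thesis
      unfolding Bochner_Integration.integral_diff[OF iN] Bochner_Integration.integral_diff[OF iN(2,1)] by linarith
  qed
  obtain n0 where n0: "\<And>n. n \<ge> n0 \<Longrightarrow> 
     norm ((\<integral>w. p (sine_map \<theta> (Y n w)) \<partial>M) - (\<integral>x. p (sine_map \<theta> x) \<partial>\<nu>)) < r / 3"
    using LIMSEQ_D[OF polynomial_of_sines_converges[OF char p], of "r / 3" \<theta>] r by auto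
  show "\<exists>no. \<forall>n\<ge>no. norm ((\<integral>w. F (sine_map \<theta> (Y n w)) \<partial>M) - (\<integral>x. F (sine_map \<theta> x) \<partial>\<nu>)) < r"
  proof (intro exI[of _ n0] allI impI)
    fix n assume "n \<ge> n0"
    from n0[OF this] dM[of n] dN
    show "norm ((\<integral>w. F (sine_map \<theta> (Y n w)) \<partial>M) - (\<integral>x. F (sine_map \<theta> x) \<partial>\<nu>)) < r"
      unfolding real_norm_def by linarith
  qed
qed

text \<open>The continuity theorem on a Euclidean space, with tightness as a hypothesis. Outside a large ball
  both laws have little mass, so that the integrand may be replaced by its composition with the triangle
  wave at a cost of twice its bound times that mass.\<close>

theorem converges_in_distribution_if_characteristic_functions_converge:
  assumes char: "\<And>s. (\<lambda>n. \<integral>w. iexp (s \<bullet> Y n w) \<partial>M) \<longlonglongrightarrow> (\<integral>x. iexp (s \<bullet> x) \<partial>\<nu>)"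
    and tight: "\<And>e. e > 0 \<Longrightarrow> \<exists>R. \<forall>\<^sub>F n in sequentially. measure M {w\<in>space M. norm (Y n w) > R} < e"
  shows "converges_in_distribution M Y \<nu>"
  unfolding converges_in_distribution_def
proof (intro allI impI)
  fix f :: "'a \<Rightarrow> real" assume f: "continuous_on UNIV f \<and> bounded (range f)"
  interpret M: prob_space M by (rule M)
  interpret N: prob_space \<nu> by (rule N)
  note Y[measurable]
  have idm[measurable]: "(\<lambda>x. x) \<in> borel_measurable \<nu>" by (rule measurable_ident_sets[OF sets])
  have fm[measurable]: "f \<in> borel_measurable borel" using f by (auto intro: borel_measurable_continuous_onI)
  obtain B where B: "\<And>x. \<bar>f x\<bar> \<le> B" and B0: "B > 0" 
    using f by (auto simp: bounded_pos)
  have "(\<lambda>n. \<integral>w. f (Y n w) \<partial>M) \<longlonglongrightarrow> (\<integral>x. f x \<partial>\<nu>)"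
  proof (rule LIMSEQ_I)
    fix r :: real assume r: "r > 0"
    define e where "e = r / (6 * B)"
    have e: "e > 0" "2 * B * e = r / 3" using r B0 by (auto simp: e_def)
    obtain R1 where R1: "\<forall>\<^sub>F n in sequentially. measure M {w\<in>space M. norm (Y n w) > R1} < e"
      using tight[OF e(1)] by blast
    have "(\<lambda>k. measure \<nu> {x\<in>space \<nu>. norm x > real k}) \<longlonglongrightarrow> measure \<nu> (\<Inter>k. {x\<in>space \<nu>. norm x > real k})"
      by (intro N.finite_Lim_measure_decseq) (auto simp: decseq_def)
    moreover have "(\<Inter>k. {x\<in>space \<nu>. norm x > real k}) = {}"
    proof -
      have "\<exists>k. \<not> real k < norm x" for x :: 'a
        using real_arch_simple[of "norm x"] by (auto simp: not_less)
      then show ?thesis by blast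
    qed
    ultimately have "(\<lambda>k. measure \<nu> {x\<in>space \<nu>. norm x > real k}) \<longlonglongrightarrow> 0" by simp
    then have "\<forall>\<^sub>F k in sequentially. measure \<nu> {x\<in>space \<nu>. norm x > real k} < e"
      using e(1) order_tendstoD(2) by blast
    then obtain k where k: "measure \<nu> {x\<in>space \<nu>. norm x > real k} < e"
      unfolding eventually_sequentially by blast
    define R where "R = max 1 (max R1 (real k))"
    have R: "R > 0" "R1 \<le> R" "real k \<le> R" by (auto simp: R_def)
    define \<theta> where "\<theta> = pi / (2 * R)"
    have \<theta>: "\<theta> > 0" "pi / (2 * \<theta>) = R" using R by (auto simp: \<theta>_def)
    define F where "F = f \<circ> arcsine_map \<theta>"
    define g where "g x = F (sine_map \<theta> x)" for x
    have F: "continuous_on (cbox (- One) One) F"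
      unfolding F_def using f by (intro continuous_on_compose continuous_on_arcsine_map \<theta>) (blast intro: continuous_on_subset)
    have gm[measurable]: "g \<in> borel_measurable borel" unfolding g_def
      by (intro borel_measurable_continuous_onI continuous_on_compose2[OF F continuous_sine_map])
        (use sine_map_mem in auto)
    have gB: "\<bar>g x\<bar> \<le> B" for x using B by (simp add: g_def F_def)
    have fg: "f x = g x" if "norm x \<le> R" for x
      using that arcsine_map_sine_map[OF \<theta>(1), of x] by (simp add: g_def F_def \<theta>)
    have mono: "{w\<in>space M. norm (Y n w) > R} \<subseteq> {w\<in>space M. norm (Y n w) > R1}" for n
      using R by auto
    have mono': "{w\<in>space \<nu>. norm w > R} \<subseteq> {w\<in>space \<nu>. norm w > real k}"
      using R by auto
    have dN: "\<bar>(\<integral>x. f x \<partial>\<nu>) - (\<integral>x. g x \<partial>\<nu>)\<bar> \<le> r / 3"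
    proof -
      have "\<bar>(\<integral>x. f x \<partial>\<nu>) - (\<integral>x. g x \<partial>\<nu>)\<bar> \<le> 2 * B * measure \<nu> {w\<in>space \<nu>. norm w > R}"
        by (rule expectation_diff_le_prob[OF N idm]) (use B gB fg in auto)
      also have "measure \<nu> {w\<in>space \<nu>. norm w > R} \<le> e"
        using N.finite_measure_mono[OF mono'] k by simp
      finally show ?thesis using e B0 by (simp add: mult_left_mono)
    qed
    have "(\<lambda>n. \<integral>w. g (Y n w) \<partial>M) \<longlonglongrightarrow> (\<integral>x. g x \<partial>\<nu>)"
      unfolding g_def by (rule continuous_of_sines_converges[OF char F])
    then have "\<forall>\<^sub>F n in sequentially. \<bar>(\<integral>w. g (Y n w) \<partial>M) - (\<integral>x. g x \<partial>\<nu>)\<bar> < r / 3"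
      using r unfolding LIMSEQ_iff eventually_sequentially real_norm_def by (meson zero_less_divide_iff zero_less_numeral)
    with R1 have "\<forall>\<^sub>F n in sequentially. norm ((\<integral>w. f (Y n w) \<partial>M) - (\<integral>x. f x \<partial>\<nu>)) < r"
    proof eventually_elim
      case (elim n)
      have "\<bar>(\<integral>w. f (Y n w) \<partial>M) - (\<integral>w. g (Y n w) \<partial>M)\<bar> \<le> 2 * B * measure M {w\<in>space M. norm (Y n w) > R}"
        by (rule expectation_diff_le_prob[OF M]) (use B gB fg in auto)
      also have "measure M {w\<in>space M. norm (Y n w) > R} \<le> e"
        using M.finite_measure_mono[OF mono[of n]] elim(1) by simp
      finally have "\<bar>(\<integral>w. f (Y n w) \<partial>M) - (\<integral>w. g (Y n w) \<partial>M)\<bar> \<le> r / 3"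
        using e B0 by (simp add: mult_left_mono)
      with elim(2) dN show ?case unfolding real_norm_def by linarith
    qed
    then show "\<exists>no. \<forall>n\<ge>no. norm ((\<integral>w. f (Y n w) \<partial>M) - (\<integral>x. f x \<partial>\<nu>)) < r"
      by (simp add: eventually_sequentially)
  qed
  then show "(\<lambda>n. \<integral>x. f x \<partial>distr M borel (Y n)) \<longlonglongrightarrow> (\<integral>x. f x \<partial>\<nu>)"
    by (simp add: integral_distr)
qed

end

lemma norm_iexp_diff_le: "norm (iexp a - iexp b) \<le> min 2 \<bar>a - b\<bar>"
proof -
  have eq: "iexp a - iexp b = iexp b * (iexp (a - b) - 1)"
    by (simp add: ring_distribs flip: exp_add)
  have "norm (iexp (a - b) - 1) \<le> \<bar>a - b\<bar>"
    using iexp_approx1[of "a - b" 0] by simp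
  moreover have "norm (iexp a - iexp b) \<le> 1 + 1"
    using norm_triangle_ineq4[of "iexp a" "iexp b"] by simp
  ultimately show ?thesis unfolding eq by (simp add: norm_mult)
qed

lemma characteristic_functions_of_close_variables:
  fixes Y W :: "nat \<Rightarrow> 'w \<Rightarrow> 'a::euclidean_space"
  assumes M: "prob_space M" and Y: "\<And>n. Y n \<in> borel_measurable M" and W: "\<And>n. W n \<in> borel_measurable M"
    and close: "\<And>e. e > 0 \<Longrightarrow> (\<lambda>n. measure M {w\<in>space M. norm (Y n w - W n w) > e}) \<longlonglongrightarrow> 0"
  shows "(\<lambda>n. (\<integral>w. iexp (s \<bullet> Y n w) \<partial>M) - (\<integral>w. iexp (s \<bullet> W n w) \<partial>M)) \<longlonglongrightarrow> 0"
proof (rule LIMSEQ_I)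
  fix r :: real assume r: "r > 0"
  interpret prob_space M by fact
  note Y[measurable] W[measurable]
  define e where "e = r / (2 * (norm s + 1))"
  have e: "e > 0" using r by (auto simp: e_def add_nonneg_pos)
  have "norm s * e \<le> (norm s + 1) * e" using e by simp
  also have "\<dots> = r / 2"
    unfolding e_def by (simp add: field_simps add_nonneg_eq_0_iff)
  finally have e': "norm s * e \<le> r / 2" .
  have bound: "norm ((\<integral>w. iexp (s \<bullet> Y n w) \<partial>M) - (\<integral>w. iexp (s \<bullet> W n w) \<partial>M))
      \<le> norm s * e + 2 * measure M {w\<in>space M. norm (Y n w - W n w) > e}" for n
  proof -
    have i: "integrable M (\<lambda>w. iexp (s \<bullet> Y n w))" "integrable M (\<lambda>w. iexp (s \<bullet> W n w))"
      by (rule integrable_const_bound[where B=1]; simp)+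
    have "norm (\<integral>w. iexp (s \<bullet> Y n w) - iexp (s \<bullet> W n w) \<partial>M)
       \<le> (\<integral>w. norm (iexp (s \<bullet> Y n w) - iexp (s \<bullet> W n w)) \<partial>M)"
      by (rule integral_norm_bound)
    also have "\<dots> \<le> (\<integral>w. norm s * e + 2 * indicator {w\<in>space M. norm (Y n w - W n w) > e} w \<partial>M)"
    proof (rule integral_mono)
      show "integrable M (\<lambda>w. norm s * e + 2 * indicator {w\<in>space M. norm (Y n w - W n w) > e} w)"
        by (intro Bochner_Integration.integrable_add integrable_mult_right integrable_real_indicator)
          (auto simp: emeasure_eq_measure)
      show "norm (iexp (s \<bullet> Y n w) - iexp (s \<bullet> W n w))
          \<le> norm s * e + 2 * indicator {w\<in>space M. norm (Y n w - W n w) > e} w" if "w \<in> space M" for w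
      proof (cases "norm (Y n w - W n w) > e")
        case True
        have "norm (iexp (s \<bullet> Y n w) - iexp (s \<bullet> W n w)) \<le> 2"
          using norm_iexp_diff_le[of "s \<bullet> Y n w" "s \<bullet> W n w"] by simp
        with True that e show ?thesis by (simp add: add_increasing)
      next
        case False
        have "\<bar>s \<bullet> Y n w - s \<bullet> W n w\<bar> \<le> norm s * norm (Y n w - W n w)"
          unfolding inner_diff_right[symmetric] by (rule Cauchy_Schwarz_ineq2)
        also have "\<dots> \<le> norm s * e" using False by (intro mult_left_mono) auto
        finally show ?thesis
          using norm_iexp_diff_le[of "s \<bullet> Y n w" "s \<bullet> W n w"] by (simp add: indicator_def)
      qed
    qed (use i in auto)
    also have "\<dots> = norm s * e + 2 * measure M {w\<in>space M. norm (Y n w - W n w) > e}"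
      by (subst Bochner_Integration.integral_add)
        (auto simp: emeasure_eq_measure prob_space intro!: integrable_mult_right integrable_real_indicator)
    finally show ?thesis using i by simp
  qed
  have "\<forall>\<^sub>F n in sequentially. measure M {w\<in>space M. norm (Y n w - W n w) > e} < r / 4"
    using close[OF e] r by (intro order_tendstoD(2)) auto
  then have "\<forall>\<^sub>F n in sequentially. norm ((\<integral>w. iexp (s \<bullet> Y n w) \<partial>M) - (\<integral>w. iexp (s \<bullet> W n w) \<partial>M) - 0) < r"
  proof eventually_elim
    case (elim n)
    then show ?case using bound[of n] e' unfolding diff_zero by linarith
  qed
  then show "\<exists>no. \<forall>n\<ge>no. norm ((\<integral>w. iexp (s \<bullet> Y n w) \<partial>M) - (\<integral>w. iexp (s \<bullet> W n w) \<partial>M) - 0) < r"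
    unfolding eventually_sequentially .
qed

text \<open>A Slutsky lemma: the limit law of \<open>W n\<close> is inherited by every \<open>Y n\<close> whose distance to \<open>W n\<close> tends
  to \<open>0\<close> in probability. A bound on the first moments of \<open>W n\<close> supplies tightness through Markov's
  inequality.\<close>

theorem converges_in_distribution_if_close:
  fixes Y W :: "nat \<Rightarrow> 'w \<Rightarrow> 'a::euclidean_space"
  assumes M: "prob_space M" and Y: "\<And>n. Y n \<in> borel_measurable M" and W: "\<And>n. W n \<in> borel_measurable M"
    and N: "prob_space \<nu>" and sets: "sets \<nu> = sets borel"
    and char: "\<And>s. (\<lambda>n. \<integral>w. iexp (s \<bullet> W n w) \<partial>M) \<longlonglongrightarrow> (\<integral>x. iexp (s \<bullet> x) \<partial>\<nu>)"
    and int: "\<And>n. integrable M (\<lambda>w. norm (W n w))"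
    and bdd: "\<forall>\<^sub>F n in sequentially. (\<integral>w. norm (W n w) \<partial>M) \<le> C"
    and close: "\<And>e. e > 0 \<Longrightarrow> (\<lambda>n. measure M {w\<in>space M. norm (Y n w - W n w) > e}) \<longlonglongrightarrow> 0"
  shows "converges_in_distribution M Y \<nu>"
proof (rule converges_in_distribution_if_characteristic_functions_converge[OF M Y N sets])
  interpret prob_space M by fact
  note Y[measurable] W[measurable]
  show "(\<lambda>n. \<integral>w. iexp (s \<bullet> Y n w) \<partial>M) \<longlonglongrightarrow> (\<integral>x. iexp (s \<bullet> x) \<partial>\<nu>)" for s
    using tendsto_add[OF char[of s] characteristic_functions_of_close_variables[OF M Y W close, of s]] by simp
  fix e :: real assume e: "e > 0"
  define R where "R = 2 * (\<bar>C\<bar> + 1) / e"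
  have R: "R > 0" using e by (simp add: R_def)
  have "\<forall>\<^sub>F n in sequentially. measure M {w\<in>space M. norm (Y n w - W n w) > 1} < e / 2"
    using close[of 1] e by (intro order_tendstoD(2)) auto
  with bdd have "\<forall>\<^sub>F n in sequentially. measure M {w\<in>space M. norm (Y n w) > R + 1} < e"
  proof eventually_elim
    case (elim n)
    have "measure M {w\<in>space M. norm (W n w) \<ge> R} \<le> (\<integral>w. norm (W n w) \<partial>M) / R"
      by (intro integral_Markov_inequality_measure[where A="{}"] int R) auto
    also have "\<dots> \<le> C / R" using elim R by (simp add: divide_right_mono)
    also have "C / R < (\<bar>C\<bar> + 1) / R" using R by (intro divide_strict_right_mono) auto
    also have "\<dots> = e / 2" using e by (simp add: R_def field_simps add_nonneg_eq_0_iff)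
    finally have W': "measure M {w\<in>space M. norm (W n w) \<ge> R} < e / 2" .
    have "measure M {w\<in>space M. norm (Y n w) > R + 1} 
       \<le> measure M ({w\<in>space M. norm (W n w) \<ge> R} \<union> {w\<in>space M. norm (Y n w - W n w) > 1})"
    proof (rule finite_measure_mono)
      show "{w\<in>space M. norm (Y n w) > R + 1} 
        \<subseteq> {w\<in>space M. norm (W n w) \<ge> R} \<union> {w\<in>space M. norm (Y n w - W n w) > 1}"
      proof safe
        fix w assume *: "\<not> 1 < norm (Y n w - W n w)" "R + 1 < norm (Y n w)"
        show "R \<le> norm (W n w)"
          using * norm_triangle_ineq2[of "Y n w" "W n w"] by linarith
      qed
    qed measurable
    also have "\<dots> \<le> measure M {w\<in>space M. norm (W n w) \<ge> R} + measure M {w\<in>space M. norm (Y n w - W n w) > 1}"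
      by (intro measure_Un_le) measurable
    finally show ?case using W' elim by linarith
  qed
  then show "\<exists>R. \<forall>\<^sub>F n in sequentially. measure M {w\<in>space M. norm (Y n w) > R} < e" by blast
qed

section \<open>Normal laws and Gaussian processes\<close>

text \<open>The degenerate and the nondegenerate case of \<open>normal_law\<close> are unified by this representation, in
  which a vanishing variance makes the affine map constant.\<close>

lemma normal_law_eq_affine_image:
  assumes "v \<ge> 0"
  shows "normal_law m v = distr std_normal_distribution borel (\<lambda>x. m + sqrt v * x)"
proof -
  interpret N: real_distribution std_normal_distribution by (rule real_dist_normal_dist)
  show ?thesis
  proof (cases "v = 0")
    case True
    have "return borel m = distr std_normal_distribution borel (\<lambda>x. m)"
      using N.distr_const[of m borel] by simp
    with True show ?thesis by (simp add: normal_law_def)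
  next
    case False
    have "distributed std_normal_distribution lborel (\<lambda>x. x) std_normal_density"
      by (auto simp: distributed_def distr_id2)
    then have "distributed std_normal_distribution lborel (\<lambda>x. m + sqrt v * x)
        (normal_density (m + sqrt v * 0) (\<bar>sqrt v\<bar> * 1))"
      by (rule N.normal_density_affine) (use assms False in auto)
    then have "distr std_normal_distribution lborel (\<lambda>x. m + sqrt v * x) 
        = density lborel (normal_density m (sqrt v))"
      using assms by (simp add: distributed_def)
    moreover have "distr std_normal_distribution lborel (\<lambda>x. m + sqrt v * x)
       = distr std_normal_distribution borel (\<lambda>x. m + sqrt v * x)"
      by (rule distr_cong) auto
    ultimately show ?thesis using False by (simp add: normal_law_def)
  qed
qed

lemma normal_law_expectations:
  assumes "v \<ge> 0"
  shows "integrable (normal_law m v) (\<lambda>x. x)" "integrable (normal_law m v) (\<lambda>x. x\<^sup>2)"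
    and "(\<integral>x. x \<partial>normal_law m v) = m" "(\<integral>x. x\<^sup>2 \<partial>normal_law m v) = m\<^sup>2 + v"
    and "(\<integral>x. iexp x \<partial>normal_law m v) = iexp m * exp (- v / 2)"
proof -
  interpret N: real_distribution std_normal_distribution by (rule real_dist_normal_dist)
  note eq = normal_law_eq_affine_image[OF assms]
  have i: "integrable std_normal_distribution (\<lambda>x. x)" "integrable std_normal_distribution (\<lambda>x. x\<^sup>2)"
    using integrable_std_normal_distribution_moment[of 1] integrable_std_normal_distribution_moment[of 2] by auto
  have e: "(\<integral>x. x \<partial>std_normal_distribution) = 0" "(\<integral>x. x\<^sup>2 \<partial>std_normal_distribution) = 1"
    using integral_std_normal_distribution_moment_odd[of 1] std_normal_distribution_even_moments(1)[of 1]
    by (auto simp: fact_numeral)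
  have sq: "(m + sqrt v * x)\<^sup>2 = m\<^sup>2 + (2 * m * sqrt v) * x + v * x\<^sup>2" for x
    using assms by (simp add: power2_sum power_mult_distrib)
  show "integrable (normal_law m v) (\<lambda>x. x)" "integrable (normal_law m v) (\<lambda>x. x\<^sup>2)"
    unfolding eq by (subst integrable_distr_eq, simp_all add: sq i)+
  show "(\<integral>x. x \<partial>normal_law m v) = m"
    unfolding eq by (subst integral_distr) (simp_all add: i e N.prob_space[simplified])
  show "(\<integral>x. x\<^sup>2 \<partial>normal_law m v) = m\<^sup>2 + v"
    unfolding eq by (subst integral_distr) (simp_all add: sq i e N.prob_space[simplified])
  have "(\<integral>x. iexp x \<partial>normal_law m v) = (\<integral>x. iexp m * iexp (sqrt v * x) \<partial>std_normal_distribution)"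
    unfolding eq by (subst integral_distr) (simp_all add: exp_add ring_distribs)
  also have "\<dots> = iexp m * char std_normal_distribution (sqrt v)"
    by (simp add: char_def)
  also have "\<dots> = iexp m * exp (- v / 2)"
    unfolding char_std_normal_distribution using assms by simp
  finally show "(\<integral>x. iexp x \<partial>normal_law m v) = iexp m * exp (- v / 2)" .
qed

lemma char_normal_density:
  assumes "v > 0"
  shows "(\<integral>y. iexp (s * y) \<partial>density lborel (normal_density 0 (sqrt v))) = exp (- v * s\<^sup>2 / 2)"
proof -
  have "density lborel (normal_density 0 (sqrt v)) = distr std_normal_distribution borel (\<lambda>x. 0 + sqrt v * x)"
    using assms normal_law_eq_affine_image[of v 0] by (simp add: normal_law_def)
  also have "(\<integral>y. iexp (s * y) \<partial>\<dots>) = char std_normal_distribution (s * sqrt v)"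
    by (subst integral_distr) (auto simp: char_def mult.assoc)
  also have "\<dots> = exp (- v * s\<^sup>2 / 2)"
    using assms by (simp add: char_std_normal_distribution power_mult_distrib mult.commute)
  finally show ?thesis .
qed

lemma normal_random_variable_expectations:
  assumes [measurable]: "X \<in> borel_measurable M" and D: "distr M borel X = normal_law m v" and "v \<ge> 0"
  shows "integrable M X" "integrable M (\<lambda>w. (X w)\<^sup>2)"
    and "(\<integral>w. X w \<partial>M) = m" "(\<integral>w. (X w)\<^sup>2 \<partial>M) = m\<^sup>2 + v"
    and "(\<integral>w. iexp (X w) \<partial>M) = iexp m * exp (- v / 2)"
proof -
  note * = normal_law_expectations[OF \<open>v \<ge> 0\<close>, of m, folded D]
  show "integrable M X" using *(1) by (simp add: integrable_distr_eq)
  show "integrable M (\<lambda>w. (X w)\<^sup>2)" using *(2) by (simp add: integrable_distr_eq)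
  show "(\<integral>w. X w \<partial>M) = m" using *(3) by (simp add: integral_distr)
  show "(\<integral>w. (X w)\<^sup>2 \<partial>M) = m\<^sup>2 + v" using *(4) by (simp add: integral_distr)
  show "(\<integral>w. iexp (X w) \<partial>M) = iexp m * exp (- v / 2)" using *(5) by (simp add: integral_distr)
qed

lemma centered_stationary_gaussian_process_integrable:
  assumes Z: "centered_stationary_gaussian_process M K Z" and "t \<ge> 0" "s \<ge> 0"
  shows "Z t \<in> borel_measurable M" "integrable M (Z t)" "integrable M (\<lambda>w. Z t w * Z s w)"
proof -
  have m: "Z u \<in> borel_measurable M" if "u \<ge> 0" for u
    using Z that by (auto simp: centered_stationary_gaussian_process_def gaussian_process_def)
  have i: "integrable M (Z u) \<and> integrable M (\<lambda>w. (Z u w)\<^sup>2)" if "u \<ge> 0" for u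
  proof -
    have "\<exists>m v. v \<ge> 0 \<and> distr M borel (\<lambda>w. \<Sum>t\<in>J. c t * Z t w) = normal_law m v" 
      if "finite J" "J \<subseteq> {0..}" for J and c :: "real \<Rightarrow> real"
      using Z that by (simp add: centered_stationary_gaussian_process_def gaussian_process_def)
    from this[of "{u}" "\<lambda>_. 1"] that obtain m v where "v \<ge> 0" "distr M borel (Z u) = normal_law m v"
      by auto
    then show ?thesis
      using normal_random_variable_expectations(1,2)[OF m[OF that]] by auto
  qed
  show "Z t \<in> borel_measurable M" "integrable M (Z t)" using m i assms by auto
  note m[OF \<open>t \<ge> 0\<close>, measurable] m[OF \<open>s \<ge> 0\<close>, measurable]
  show "integrable M (\<lambda>w. Z t w * Z s w)"
  proof (rule Bochner_Integration.integrable_bound)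
    show "integrable M (\<lambda>w. (Z t w)\<^sup>2 + (Z s w)\<^sup>2)" using i assms by auto
    have "\<bar>x * y\<bar> \<le> x\<^sup>2 + y\<^sup>2" for x y :: real
      using sum_squares_bound[of x y] sum_squares_bound[of x "- y"] zero_le_power2[of x] zero_le_power2[of y]
      by (auto simp: abs_le_iff)
    then show "AE w in M. norm (Z t w * Z s w) \<le> norm ((Z t w)\<^sup>2 + (Z s w)\<^sup>2)" by auto
  qed measurable
qed

text \<open>A linear combination is normal with mean \<open>0\<close>, so its characteristic function is determined by its
  variance, which is the quadratic form of the covariance.\<close>

lemma gaussian_linear_combination:
  fixes c :: "real \<Rightarrow> real"
  assumes Z: "centered_stationary_gaussian_process M K Z" and J: "finite J" "J \<subseteq> {0..}"
  shows "integrable M (\<lambda>w. (\<Sum>t\<in>J. c t * Z t w)\<^sup>2)"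
    and "(\<integral>w. (\<Sum>t\<in>J. c t * Z t w)\<^sup>2 \<partial>M) = (\<Sum>t\<in>J. \<Sum>s\<in>J. c t * c s * K \<bar>t - s\<bar>)"
    and "(\<integral>w. iexp (\<Sum>t\<in>J. c t * Z t w) \<partial>M) = exp (- (\<Sum>t\<in>J. \<Sum>s\<in>J. c t * c s * K \<bar>t - s\<bar>) / 2)"
proof -
  define X where "X w = (\<Sum>t\<in>J. c t * Z t w)" for w
  note i = centered_stationary_gaussian_process_integrable[OF Z]
  have m: "X \<in> borel_measurable M" unfolding X_def
    by (intro borel_measurable_sum borel_measurable_times i) (use J in auto)
  obtain m v where mv: "v \<ge> 0" "distr M borel X = normal_law m v"
    using Z J unfolding centered_stationary_gaussian_process_def gaussian_process_def X_def by blast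
  note N = normal_random_variable_expectations[OF m mv(2,1)]
  have "(\<integral>w. X w \<partial>M) = (\<Sum>t\<in>J. c t * (\<integral>w. Z t w \<partial>M))"
    unfolding X_def using i J by (subst Bochner_Integration.integral_sum) auto
  also have "\<dots> = 0"
    using Z J by (intro sum.neutral) (auto simp: centered_stationary_gaussian_process_def)
  finally have m0: "m = 0" using N by simp
  have sq: "(X w)\<^sup>2 = (\<Sum>t\<in>J. \<Sum>s\<in>J. c t * c s * (Z t w * Z s w))" for w
    unfolding X_def power2_eq_square sum_product by (simp add: mult_ac)
  have J0: "t \<ge> 0" if "t \<in> J" for t using J that by auto
  have "(\<integral>w. (X w)\<^sup>2 \<partial>M) = (\<Sum>t\<in>J. \<integral>w. (\<Sum>s\<in>J. c t * c s * (Z t w * Z s w)) \<partial>M)"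
    unfolding sq by (intro Bochner_Integration.integral_sum Bochner_Integration.integrable_sum integrable_mult_right i J0)
  also have "\<dots> = (\<Sum>t\<in>J. \<Sum>s\<in>J. \<integral>w. c t * c s * (Z t w * Z s w) \<partial>M)"
    by (intro sum.cong refl Bochner_Integration.integral_sum integrable_mult_right i J0)
  also have "\<dots> = (\<Sum>t\<in>J. \<Sum>s\<in>J. c t * c s * K \<bar>t - s\<bar>)"
    using Z J by (intro sum.cong refl) (auto simp: centered_stationary_gaussian_process_def)
  finally have v: "(\<integral>w. (X w)\<^sup>2 \<partial>M) = (\<Sum>t\<in>J. \<Sum>s\<in>J. c t * c s * K \<bar>t - s\<bar>)" .
  show "integrable M (\<lambda>w. (\<Sum>t\<in>J. c t * Z t w)\<^sup>2)" using N(2) unfolding X_def .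
  show "(\<integral>w. (\<Sum>t\<in>J. c t * Z t w)\<^sup>2 \<partial>M) = (\<Sum>t\<in>J. \<Sum>s\<in>J. c t * c s * K \<bar>t - s\<bar>)" using v unfolding X_def .
  show "(\<integral>w. iexp (\<Sum>t\<in>J. c t * Z t w) \<partial>M) = exp (- (\<Sum>t\<in>J. \<Sum>s\<in>J. c t * c s * K \<bar>t - s\<bar>) / 2)"
    using N(4,5) v m0 unfolding X_def by simp
qed

lemma matrix_inv_scaleR_mat_1:
  assumes "c \<noteq> 0"
  shows "matrix_inv (c *\<^sub>R mat 1 :: real ^ 'n ^ 'n) = (1 / c) *\<^sub>R mat 1"
proof -
  let ?A = "c *\<^sub>R mat 1 :: real ^ 'n ^ 'n" and ?B = "(1 / c) *\<^sub>R mat 1 :: real ^ 'n ^ 'n"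
  have mult: "(p *\<^sub>R mat 1 :: real ^ 'n ^ 'n) ** (q *\<^sub>R mat 1) = (p * q) *\<^sub>R mat 1" for p q
    by (simp only: scalar_matrix_assoc[symmetric] matrix_mul_lid scaleR_scaleR)
  have AB: "?A ** ?B = mat 1" "?B ** ?A = mat 1"
    unfolding mult using assms by simp_all
  have "?A ** matrix_inv ?A = mat 1 \<and> matrix_inv ?A ** ?A = mat 1"
    unfolding matrix_inv_def by (rule someI[of _ ?B]) (use AB in blast)
  then have "?B ** (?A ** matrix_inv ?A) = ?B" by simp
  then show ?thesis unfolding matrix_mul_assoc AB by simp
qed

lemma isotropic_normal_density_eq_prod:
  fixes x :: "real ^ 'n"
  assumes "c > 0"
  shows "exp (- (x \<bullet> (matrix_inv (c *\<^sub>R mat 1) *v x)) / 2) / sqrt ((2 * pi) ^ CARD('n) * det (c *\<^sub>R mat 1 :: real ^ 'n ^ 'n))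
    = (\<Prod>b\<in>Basis. normal_density 0 (sqrt c) (x \<bullet> b))"
proof -
  have "det (c *\<^sub>R mat 1 :: real ^ 'n ^ 'n) = c ^ CARD('n)"
    by (subst det_diagonal) (auto simp: mat_def)
  moreover have "x \<bullet> (matrix_inv (c *\<^sub>R mat 1) *v x) = (\<Sum>b\<in>Basis. (x \<bullet> b)\<^sup>2) / c"
    using assms by (simp add: matrix_inv_scaleR_mat_1 scaleR_matrix_vector_assoc[symmetric] euclidean_inner[of x x] power2_eq_square)
  moreover have "(\<Prod>b\<in>(Basis :: (real ^ 'n) set). normal_density 0 (sqrt c) (x \<bullet> b)) 
     = exp (- ((\<Sum>b\<in>Basis. (x \<bullet> b)\<^sup>2) / c) / 2) / sqrt ((2 * pi) ^ CARD('n) * c ^ CARD('n))"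
    using assms by (simp add: normal_density_def prod_dividef prod.distrib exp_sum[symmetric] sum_negf[symmetric] 
       sum_divide_distrib power_mult_distrib real_sqrt_power real_sqrt_mult mult.commute[of c 2])
  ultimately show ?thesis by simp
qed

lemma lborel_integral_prod_Basis:
  fixes f :: "'a::euclidean_space \<Rightarrow> real \<Rightarrow> complex"
  assumes "\<And>b. b \<in> Basis \<Longrightarrow> integrable lborel (f b)"
  shows "(\<integral>x. (\<Prod>b\<in>Basis. f b (x \<bullet> b)) \<partial>lborel) = (\<Prod>b\<in>Basis. \<integral>y. f b y \<partial>lborel)"
proof -
  have [measurable]: "\<And>b. b \<in> Basis \<Longrightarrow> f b \<in> borel_measurable borel" using assms by auto
  interpret product_sigma_finite "\<lambda>b::'a. lborel :: real measure" by standard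
  have "(\<integral>x. (\<Prod>b\<in>Basis. f b (x \<bullet> b)) \<partial>lborel)
    = (\<integral>g. (\<Prod>b\<in>Basis. f b (g b)) \<partial>(\<Pi>\<^sub>M b\<in>(Basis :: 'a set). lborel))"
  proof (subst lborel_eq, subst integral_distr)
    have "(\<Sum>b'\<in>Basis. g b' *\<^sub>R b') \<bullet> b = g b" if "b \<in> Basis" for g and b :: 'a
      using that by (simp add: inner_sum_left inner_Basis if_distrib sum.delta cong: if_cong)
    then show "(\<integral>g. (\<Prod>b\<in>Basis. f b ((\<Sum>b\<in>Basis. g b *\<^sub>R b) \<bullet> b)) \<partial>(\<Pi>\<^sub>M b\<in>(Basis :: 'a set). lborel))
       = (\<integral>g. (\<Prod>b\<in>Basis. f b (g b)) \<partial>(\<Pi>\<^sub>M b\<in>(Basis :: 'a set). lborel))"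
      by (intro Bochner_Integration.integral_cong refl prod.cong) simp
  qed measurable
  also have "\<dots> = (\<Prod>b\<in>Basis. \<integral>y. f b y \<partial>lborel)"
    by (rule product_integral_prod) (use assms in auto)
  finally show ?thesis .
qed

text \<open>The density factorizes over an orthonormal basis, which reduces total mass and characteristic
  function to the one-dimensional normal law.\<close>

lemma isotropic_normal_law:
  fixes s :: "real ^ 'n"
  assumes c: "c > 0"
  defines "\<nu> \<equiv> multivariate_normal (0 :: real ^ 'n) (c *\<^sub>R mat 1)"
  shows "sets \<nu> = sets borel" "prob_space \<nu>" "(\<integral>x. iexp (s \<bullet> x) \<partial>\<nu>) = exp (- c * (norm s)\<^sup>2 / 2)"
proof -
  let ?d = "normal_density 0 (sqrt c)"
  have \<nu>: "\<nu> = density lborel (\<lambda>x. ennreal (\<Prod>b\<in>Basis. ?d (x \<bullet> b)))"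
    unfolding \<nu>_def multivariate_normal_def diff_zero isotropic_normal_density_eq_prod[OF c] ..
  show "sets \<nu> = sets borel" by (simp add: \<nu>)
  have n1: "(\<integral>\<^sup>+y. ennreal (?d y) \<partial>lborel) = 1"
    using c by (simp add: nn_integral_eq_integral)
  show "prob_space \<nu>"
  proof
    have "emeasure \<nu> (space \<nu>) = (\<integral>\<^sup>+x. (\<Prod>b\<in>Basis. ennreal (?d (x \<bullet> b))) \<partial>(lborel :: (real ^ 'n) measure))"
      by (simp add: \<nu> emeasure_density prod_ennreal)
    also have "\<dots> = 1"
      by (subst nn_integral_lborel_prod) (auto simp: n1)
    finally show "emeasure \<nu> (space \<nu>) = 1" .
  qed
  have [measurable]: "?d \<in> borel_measurable borel" by simp
  have ie: "iexp (s \<bullet> x) = (\<Prod>b\<in>Basis. iexp ((s \<bullet> b) * (x \<bullet> b)))" for x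
    by (subst euclidean_inner) (simp add: exp_sum sum_distrib_left)
  have "(\<integral>x. iexp (s \<bullet> x) \<partial>\<nu>) = (\<integral>x. (\<Prod>b\<in>Basis. ?d (x \<bullet> b)) *\<^sub>R iexp (s \<bullet> x) \<partial>lborel)"
    unfolding \<nu> by (subst integral_density) (auto intro!: prod_nonneg)
  also have "\<dots> = (\<integral>x. (\<Prod>b\<in>Basis. ?d (x \<bullet> b) *\<^sub>R iexp ((s \<bullet> b) * (x \<bullet> b))) \<partial>lborel)"
    unfolding ie by (simp add: scaleR_conv_of_real prod.distrib)
  also have "\<dots> = (\<Prod>b\<in>Basis. \<integral>y. ?d y *\<^sub>R iexp ((s \<bullet> b) * y) \<partial>lborel)"
  proof (rule lborel_integral_prod_Basis)
    fix b :: "real ^ 'n"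
    have "integrable lborel ?d" using c by simp
    then show "integrable lborel (\<lambda>y. ?d y *\<^sub>R iexp ((s \<bullet> b) * y))"
      by (rule Bochner_Integration.integrable_bound) auto
  qed
  also have "\<dots> = (\<Prod>b\<in>(Basis :: (real ^ 'n) set). of_real (exp (- c * (s \<bullet> b)\<^sup>2 / 2)))"
  proof (intro prod.cong refl)
    fix b :: "real ^ 'n"
    have "(\<integral>y. ?d y *\<^sub>R iexp ((s \<bullet> b) * y) \<partial>lborel) = (\<integral>y. iexp ((s \<bullet> b) * y) \<partial>density lborel ?d)"
      by (subst integral_density) auto
    then show "(\<integral>y. ?d y *\<^sub>R iexp ((s \<bullet> b) * y) \<partial>lborel) = of_real (exp (- c * (s \<bullet> b)\<^sup>2 / 2))"
      unfolding char_normal_density[OF c] .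
  qed
  also have "\<dots> = of_real (exp (\<Sum>b\<in>Basis. - c * (s \<bullet> b)\<^sup>2 / 2))"
    by (simp only: exp_sum[OF finite_Basis] of_real_prod)
  also have "(\<Sum>b\<in>Basis. - c * (s \<bullet> b)\<^sup>2 / 2) = - c * (norm s)\<^sup>2 / 2"
  proof -
    have "(norm s)\<^sup>2 = (\<Sum>b\<in>Basis. (s \<bullet> b)\<^sup>2)"
      by (subst power2_norm_eq_inner, subst euclidean_inner) (simp add: power2_eq_square)
    then show ?thesis by (simp add: sum_distrib_left sum_divide_distrib)
  qed
  finally show "(\<integral>x. iexp (s \<bullet> x) \<partial>\<nu>) = exp (- c * (norm s)\<^sup>2 / 2)" .
qed

section \<open>Trigonometric sums and Riemann sums on the half-line\<close>

lemma polar_form: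
  fixes p q :: real
  obtains \<phi> where "\<And>t. p * cos t + q * sin t = sqrt (p\<^sup>2 + q\<^sup>2) * cos (t + \<phi>)"
proof (cases "p = 0 \<and> q = 0")
  case True then show ?thesis using that[of 0] by simp
next
  case False
  define r where "r = sqrt (p\<^sup>2 + q\<^sup>2)"
  have r: "r > 0" "r\<^sup>2 = p\<^sup>2 + q\<^sup>2"
    using False by (auto simp: r_def sum_power2_gt_zero_iff)
  have "(p / r)\<^sup>2 + (- q / r)\<^sup>2 = 1"
    using r(1) by (simp add: power_divide r(2)[symmetric] flip: add_divide_distrib)
  then obtain \<phi> where "p / r = cos \<phi>" "- q / r = sin \<phi>" by (rule sincos_total_2pi)
  then have "p = r * cos \<phi>" "q = - r * sin \<phi>" using r(1) by (auto simp: field_simps)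
  then have "p * cos t + q * sin t = r * cos (t + \<phi>)" for t
    by (simp add: cos_add algebra_simps)
  then show ?thesis unfolding r_def by (rule that)
qed

text \<open>Multiplication by \<open>2 * sin \<alpha>\<close> telescopes the sum. The bound does not depend on the number of terms,
  so oscillating sums contribute only boundary effects below.\<close>

lemma abs_sum_cos_le:
  assumes "sin \<alpha> > 0"
  shows "\<bar>\<Sum>i=1..m. cos (2 * real i * \<alpha> + \<beta>)\<bar> \<le> 1 / sin \<alpha>"
proof -
  have "2 * sin \<alpha> * (\<Sum>i=1..m. cos (2 * real i * \<alpha> + \<beta>))
      = (\<Sum>i=1..m. sin (2 * real i * \<alpha> + \<beta> + \<alpha>) - sin (2 * real (i - 1) * \<alpha> + \<beta> + \<alpha>))"
    unfolding sum_distrib_left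
  proof (intro sum.cong refl)
    fix i assume "i \<in> {1..m}"
    then have "2 * real (i - 1) * \<alpha> + \<beta> + \<alpha> = (2 * real i * \<alpha> + \<beta>) - \<alpha>"
      by (auto simp: of_nat_diff algebra_simps)
    then show "2 * sin \<alpha> * cos (2 * real i * \<alpha> + \<beta>)
       = sin (2 * real i * \<alpha> + \<beta> + \<alpha>) - sin (2 * real (i - 1) * \<alpha> + \<beta> + \<alpha>)"
      by (simp only: sin_add[of _ \<alpha>] sin_diff) (simp add: algebra_simps)
  qed
  also have "\<dots> = sin (2 * real m * \<alpha> + \<beta> + \<alpha>) - sin (\<beta> + \<alpha>)"
    by (induction m) (auto simp: algebra_simps)
  finally have "\<bar>2 * sin \<alpha> * (\<Sum>i=1..m. cos (2 * real i * \<alpha> + \<beta>))\<bar> \<le> 1 + 1"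
    using abs_sin_le_one[of "2 * real m * \<alpha> + \<beta> + \<alpha>"] abs_sin_le_one[of "\<beta> + \<alpha>"] by linarith
  then show ?thesis using assms by (simp add: abs_mult field_simps)
qed

lemma double_sum_by_lag:
  fixes F :: "nat \<Rightarrow> nat \<Rightarrow> real"
  assumes sym: "\<And>i j. F i j = F j i"
  shows "(\<Sum>i=1..n. \<Sum>j=1..n. F i j) = (\<Sum>i=1..n. F i i) + 2 * (\<Sum>k=1..n. \<Sum>i=1..n-k. F i (i + k))"
proof (induction n)
  case (Suc n)
  have row: "(\<Sum>i=1..n. F i (Suc n)) = (\<Sum>k=1..n. F (Suc n - k) (Suc n))"
    by (rule sum.reindex_bij_witness[where i="\<lambda>k. Suc n - k" and j="\<lambda>k. Suc n - k"]) auto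
  have "(\<Sum>k=1..Suc n. \<Sum>i=1..Suc n-k. F i (i + k)) = (\<Sum>k=1..n. \<Sum>i=1..Suc (n-k). F i (i + k))"
    by (simp add: Suc_diff_le)
  also have "\<dots> = (\<Sum>k=1..n. (\<Sum>i=1..n-k. F i (i + k)) + F (Suc n - k) (Suc n))"
    by (intro sum.cong refl) (auto simp: Suc_diff_le)
  finally have lag: "(\<Sum>k=1..Suc n. \<Sum>i=1..Suc n-k. F i (i + k)) 
      = (\<Sum>k=1..n. \<Sum>i=1..n-k. F i (i + k)) + (\<Sum>i=1..n. F i (Suc n))"
    using row by (simp add: sum.distrib)
  have "(\<Sum>i=1..Suc n. \<Sum>j=1..Suc n. F i j) 
     = (\<Sum>i=1..n. \<Sum>j=1..n. F i j) + 2 * (\<Sum>i=1..n. F i (Suc n)) + F (Suc n) (Suc n)"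
  proof -
    have "(\<Sum>j=1..n. F (Suc n) j) = (\<Sum>i=1..n. F i (Suc n))" by (intro sum.cong refl sym)
    then show ?thesis by (simp add: sum.distrib)
  qed
  with Suc lag show ?case by simp
qed simp

text \<open>Riemann sums on the half-line are written as integrals of step functions that take the value of the
  right end point of each grid cell. For a decreasing kernel the step function then stays below the
  kernel, which makes dominated convergence available on an unbounded domain.\<close>

definition step_function :: "real \<Rightarrow> nat \<Rightarrow> (nat \<Rightarrow> real) \<Rightarrow> real \<Rightarrow> real" where
  "step_function h n v u = (\<Sum>k=1..n. v k * indicator {real (k - 1) * h <.. real k * h} u)"

lemma step_function_eq:
  assumes "h > 0" "u > 0"
  shows "step_function h n v u = (if nat \<lceil>u / h\<rceil> \<le> n then v (nat \<lceil>u / h\<rceil>) else 0)"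
proof -
  define m where "m = nat \<lceil>u / h\<rceil>"
  have "u / h > 0" using assms by simp
  then have m1: "m \<ge> 1" unfolding m_def by linarith
  have "v k * indicator {real (k - 1) * h <.. real k * h} u = (if k = m then v k else 0)" if "k \<in> {1..n}" for k
  proof -
    have "u \<in> {real (k - 1) * h <.. real k * h} \<longleftrightarrow> real k - 1 < u / h \<and> u / h \<le> real k"
      using assms that by (auto simp: field_simps of_nat_diff)
    also have "\<dots> \<longleftrightarrow> \<lceil>u / h\<rceil> = int k" by linarith
    also have "\<dots> \<longleftrightarrow> k = m" using that m1 unfolding m_def by auto
    finally show ?thesis by (simp add: indicator_def)
  qed
  then have "step_function h n v u = (\<Sum>k=1..n. if k = m then v k else 0)"
    unfolding step_function_def by (intro sum.cong refl)
  then show ?thesis using m1 by (simp add: m_def)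
qed

lemma step_function_nonpos: "h > 0 \<Longrightarrow> u \<le> 0 \<Longrightarrow> step_function h n v u = 0"
  unfolding step_function_def
  by (intro sum.neutral) (auto simp: indicator_def not_less intro: order.trans)

lemma integral_step_function:
  assumes "h > 0"
  shows "integrable lborel (step_function h n v)" "(\<integral>u. step_function h n v u \<partial>lborel) = (\<Sum>k=1..n. h * v k)"
proof -
  have *: "has_bochner_integral lborel (\<lambda>u. v k * indicator {real (k - 1) * h <.. real k * h} u) (h * v k)" if "k \<in> {1..n}" for k
  proof -
    have "has_bochner_integral lborel (indicator {real (k - 1) * h <.. real k * h} :: real \<Rightarrow> real) 
       (measure lborel {real (k - 1) * h <.. real k * h})"
      using assms by (intro has_bochner_integral_real_indicator) (auto simp: emeasure_lborel_Ioc that)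
    also have "measure lborel {real (k - 1) * h <.. real k * h} = h"
      using assms that by (simp add: of_nat_diff algebra_simps)
    finally have "has_bochner_integral lborel (\<lambda>u. v k * indicator {real (k - 1) * h <.. real k * h} u) (v k * h)"
      by (rule has_bochner_integral_mult_right)
    then show ?thesis by (simp only: mult.commute)
  qed
  have "has_bochner_integral lborel (step_function h n v) (\<Sum>k=1..n. h * v k)"
    unfolding step_function_def by (rule has_bochner_integral_sum) (use * in auto)
  then show "integrable lborel (step_function h n v)" "(\<integral>u. step_function h n v u \<partial>lborel) = (\<Sum>k=1..n. h * v k)"
    by (auto simp: has_bochner_integral_iff)
qed

lemma ceiling_grid_point:
  assumes "h > (0::real)" "u > 0"
  shows "u \<le> real (nat \<lceil>u / h\<rceil>) * h" "real (nat \<lceil>u / h\<rceil>) * h \<le> u + h"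
proof -
  have "real (nat \<lceil>u / h\<rceil>) = real_of_int \<lceil>u / h\<rceil>" using assms by simp
  moreover have "u / h \<le> real_of_int \<lceil>u / h\<rceil>" "real_of_int \<lceil>u / h\<rceil> - 1 \<le> u / h" by linarith+
  moreover have "u / h * h = u" using assms by simp
  ultimately show "u \<le> real (nat \<lceil>u / h\<rceil>) * h" "real (nat \<lceil>u / h\<rceil>) * h \<le> u + h"
    using assms(1) mult_right_mono[of "u / h" "real_of_int \<lceil>u / h\<rceil>" h]
      mult_right_mono[of "real_of_int \<lceil>u / h\<rceil> - 1" "u / h" h]
    by (simp_all add: left_diff_distrib)
qed

lemma sin_step_asymptotics:
  fixes h :: "nat \<Rightarrow> real"
  assumes h: "\<And>n. n \<ge> 1 \<Longrightarrow> h n > 0" "h \<longlonglongrightarrow> 0" and w: "\<omega> > 0"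
  shows "\<forall>\<^sub>F n in sequentially. \<omega> * h n / 2 \<le> sin (\<omega> * h n)"
proof -
  have "((\<lambda>x. (sin (0 + x) - sin 0) / x) \<longlongrightarrow> cos 0) (at (0::real))"
    using DERIV_sin[of 0] by (simp add: DERIV_def)
  then have "((\<lambda>x. sin x / x) \<longlongrightarrow> 1) (at (0::real))" by simp
  then have "\<forall>\<^sub>F x in at (0::real). sin x / x > 1 / 2"
    by (rule order_tendstoD(1)) simp
  moreover have "filterlim (\<lambda>n. \<omega> * h n) (at 0) sequentially"
  proof (rule filterlim_atI)
    show "(\<lambda>n. \<omega> * h n) \<longlonglongrightarrow> 0" using tendsto_mult_left[OF h(2), of \<omega>] by simp
    show "\<forall>\<^sub>F n in sequentially. \<omega> * h n \<noteq> 0"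
      using eventually_ge_at_top[of 1] by eventually_elim (use h(1) w in \<open>metis less_irrefl mult_pos_pos\<close>)
  qed
  ultimately have "\<forall>\<^sub>F n in sequentially. sin (\<omega> * h n) / (\<omega> * h n) > 1 / 2"
    by (rule eventually_compose_filterlim)
  with eventually_ge_at_top[of 1] show ?thesis
  proof eventually_elim
    case (elim n)
    then have "\<omega> * h n > 0" using h(1)[of n] w by simp
    with elim show ?case by (simp add: field_simps)
  qed
qed

context
  fixes K :: "real \<Rightarrow> real"
  assumes K_nonneg: "\<And>u. u \<ge> 0 \<Longrightarrow> K u \<ge> 0"
    and K_antimono: "\<And>u v. 0 \<le> u \<Longrightarrow> u \<le> v \<Longrightarrow> K v \<le> K u"
    and K_cont: "continuous_on {0..} K"
    and K_int: "set_integrable lborel {0..} K"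
begin

lemma step_function_dominated:
  assumes "h > 0" and "\<And>k. 1 \<le> k \<Longrightarrow> k \<le> n \<Longrightarrow> \<bar>v k\<bar> \<le> K (real k * h)"
  shows "\<bar>step_function h n v u\<bar> \<le> indicator {0..} u * K u"
proof (cases "u > 0")
  case True
  have "u / h > 0" using assms True by simp
  then have "1 \<le> nat \<lceil>u / h\<rceil>" by linarith
  moreover have "K (real (nat \<lceil>u / h\<rceil>) * h) \<le> K u"
    using ceiling_grid_point[of h u] assms True by (intro K_antimono) auto
  ultimately show ?thesis
    using True assms(2)[of "nat \<lceil>u / h\<rceil>"] K_nonneg[of u] step_function_eq[OF assms(1) True, of n v] by auto
next
  case False
  then show ?thesis using step_function_nonpos[OF assms(1), of u n v] K_nonneg[of u] by (auto simp: indicator_def)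
qed

lemma riemann_sum_le_integral:
  assumes "h > 0"
  shows "(\<Sum>k=1..n. h * K (real k * h)) \<le> (LBINT u:{0..}. K u)"
proof -
  let ?f = "step_function h n (\<lambda>k. K (real k * h))"
  have "(\<Sum>k=1..n. h * K (real k * h)) = (\<integral>u. ?f u \<partial>lborel)"
    by (simp add: integral_step_function assms)
  also have "\<dots> \<le> (\<integral>u. indicator {0..} u *\<^sub>R K u \<partial>lborel)"
  proof (rule integral_mono)
    show "integrable lborel (\<lambda>u. indicator {0..} u *\<^sub>R K u)" using K_int by (simp add: set_integrable_def)
    fix u
    have "\<bar>?f u\<bar> \<le> indicator {0..} u * K u"
      by (rule step_function_dominated) (use assms K_nonneg in auto)
    then show "?f u \<le> indicator {0..} u *\<^sub>R K u" by simp
  qed (use assms integral_step_function in blast)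
  finally show ?thesis by (simp add: set_lebesgue_integral_def)
qed

text \<open>The triangular weight counts the pairs of observation times with a given lag. At a fixed lag it tends
  to \<open>1\<close>, because the length \<open>n * h n\<close> of the observation window tends to infinity.\<close>

lemma weighted_riemann_sum_tendsto:
  fixes h :: "nat \<Rightarrow> real"
  assumes h: "\<And>n. n \<ge> 1 \<Longrightarrow> h n > 0" "h \<longlonglongrightarrow> 0" "filterlim (\<lambda>n. real n * h n) at_top sequentially"
    and F: "continuous_on {0..} F" "\<And>u. u \<ge> 0 \<Longrightarrow> \<bar>F u\<bar> \<le> K u"
  shows "(\<lambda>n. \<Sum>k=1..n. h n * ((1 - real k / real n) * F (real k * h n))) \<longlonglongrightarrow> (LBINT u:{0..}. F u)"
proof -
  define f where "f n = step_function (h n) n (\<lambda>k. (1 - real k / real n) * F (real k * h n))" for n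
  have ev: "\<forall>\<^sub>F n in sequentially. n \<ge> (1::nat)" by (rule eventually_ge_at_top)
  have "(\<lambda>n. \<integral>u. f (Suc n) u \<partial>lborel) \<longlonglongrightarrow> (\<integral>u. indicator {0..} u *\<^sub>R F u \<partial>lborel)"
  proof (rule integral_dominated_convergence)
    show "integrable lborel (\<lambda>u. indicator {0..} u * K u)" using K_int by (simp add: set_integrable_def)
    show "(\<lambda>u. indicator {0..} u *\<^sub>R F u) \<in> borel_measurable lborel"
      using borel_measurable_continuous_on_indicator[OF _ F(1)] by simp
    show "f (Suc n) \<in> borel_measurable lborel" for n
      unfolding f_def using h(1)[of "Suc n"] by (intro borel_measurable_integrable integral_step_function) auto
    show "AE u in lborel. norm (f (Suc n) u) \<le> indicator {0..} u * K u" for n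
    proof (rule AE_I2)
      fix u
      have hn: "h (Suc n) > 0" by (rule h(1)) simp
      have "\<bar>(1 - real k / real (Suc n)) * F (real k * h (Suc n))\<bar> \<le> K (real k * h (Suc n))" 
        if "1 \<le> k" "k \<le> Suc n" for k
      proof -
        have "\<bar>1 - real k / real (Suc n)\<bar> \<le> 1" using that by (auto simp: field_simps)
        then have "\<bar>(1 - real k / real (Suc n)) * F (real k * h (Suc n))\<bar> \<le> 1 * \<bar>F (real k * h (Suc n))\<bar>"
          unfolding abs_mult by (intro mult_right_mono) auto
        also have "\<dots> \<le> K (real k * h (Suc n))" using F(2)[of "real k * h (Suc n)"] hn by simp
        finally show ?thesis .
      qed
      then show "norm (f (Suc n) u) \<le> indicator {0..} u * K u"
        unfolding f_def real_norm_def by (rule step_function_dominated[OF hn])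
    qed
    show "AE u in lborel. (\<lambda>n. f (Suc n) u) \<longlonglongrightarrow> indicator {0..} u *\<^sub>R F u"
    proof -
      have "(\<lambda>n. f n u) \<longlonglongrightarrow> indicator {0..} u *\<^sub>R F u" if "u \<noteq> 0" for u
      proof (cases "u > 0")
        case False
        then have "u < 0" using that by simp
        then have "\<forall>\<^sub>F n in sequentially. f n u = indicator {0..} u *\<^sub>R F u"
          by (intro eventually_mono[OF ev]) (simp add: f_def step_function_nonpos h)
        then show ?thesis by (rule tendsto_eventually)
      next
        case True
        define p where "p n = real (nat \<lceil>u / h n\<rceil>) * h n" for n
        have p: "\<forall>\<^sub>F n in sequentially. u \<le> p n \<and> p n \<le> u + h n"
          by (intro eventually_mono[OF ev]) (unfold p_def, intro conjI ceiling_grid_point h(1) True)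
        have pu: "p \<longlonglongrightarrow> u"
        proof (rule tendsto_sandwich[of "\<lambda>n. u" _ _ "\<lambda>n. u + h n"])
          show "(\<lambda>n. u + h n) \<longlonglongrightarrow> u" using tendsto_add[OF tendsto_const h(2), of u] by simp
          show "\<forall>\<^sub>F n in sequentially. u \<le> p n" "\<forall>\<^sub>F n in sequentially. p n \<le> u + h n"
            by (intro eventually_mono[OF p]; simp)+
        qed simp
        have "continuous_on {0<..} F" using F(1) by (rule continuous_on_subset) auto
        then have "isCont F u" using True by (simp add: continuous_on_eq_continuous_at)
        then have Fp: "(\<lambda>n. F (p n)) \<longlonglongrightarrow> F u" using pu by (rule isCont_tendsto_compose)
        have q: "(\<lambda>n. 1 - p n / (real n * h n)) \<longlonglongrightarrow> 1 - 0"
          by (intro tendsto_diff tendsto_const real_tendsto_divide_at_top[OF pu h(3)])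
        have "(\<lambda>n. (1 - p n / (real n * h n)) * F (p n)) \<longlonglongrightarrow> F u"
          using tendsto_mult[OF q Fp] by simp
        moreover have "\<forall>\<^sub>F n in sequentially. p n < real n * h n"
        proof -
          have "\<forall>\<^sub>F n in sequentially. p n < u + 1" using order_tendstoD(2)[OF pu, of "u + 1"] by simp
          moreover have "\<forall>\<^sub>F n in sequentially. u + 1 \<le> real n * h n" using h(3) by (simp add: filterlim_at_top)
          ultimately show ?thesis by eventually_elim linarith
        qed
        with ev have "\<forall>\<^sub>F n in sequentially. (1 - p n / (real n * h n)) * F (p n) = f n u"
        proof eventually_elim
          case (elim n)
          have hn: "h n > 0" using elim h(1) by simp
          have "real (nat \<lceil>u / h n\<rceil>) < real n" using elim(2) hn unfolding p_def by (simp only: mult_less_cancel_right_pos)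
          then have "nat \<lceil>u / h n\<rceil> \<le> n" by linarith
          moreover have "p n / (real n * h n) = real (nat \<lceil>u / h n\<rceil>) / real n"
            using hn unfolding p_def by (rule mult_divide_mult_cancel_right[OF less_imp_neq[symmetric]])
          ultimately show ?case
            unfolding f_def step_function_eq[OF hn True] p_def by simp
        qed
        ultimately have "(\<lambda>n. f n u) \<longlonglongrightarrow> F u" by (rule Lim_transform_eventually)
        then show ?thesis using True by simp
      qed
      then have "AE u in lborel. u \<noteq> 0 \<longrightarrow> (\<lambda>n. f (Suc n) u) \<longlonglongrightarrow> indicator {0..} u *\<^sub>R F u"
        using LIMSEQ_Suc by blast
      moreover have "AE u in lborel. u \<noteq> (0::real)" by (rule AE_lborel_singleton)
      ultimately show ?thesis by eventually_elim simp
    qed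
  qed
  then have "(\<lambda>n. \<integral>u. f n u \<partial>lborel) \<longlonglongrightarrow> (LBINT u:{0..}. F u)"
    unfolding set_lebesgue_integral_def by (rule LIMSEQ_imp_Suc)
  moreover have "\<forall>\<^sub>F n in sequentially. (\<integral>u. f n u \<partial>lborel) = (\<Sum>k=1..n. h n * ((1 - real k / real n) * F (real k * h n)))"
    using ev by eventually_elim (simp add: f_def integral_step_function h)
  ultimately show ?thesis by (rule Lim_transform_eventually)
qed

end

section \<open>The asymptotic variance and the cosine transforms\<close>

text \<open>This is the limiting variance. At lag \<open>k\<close>, the product of two cosines is half the cosine of the
  difference, which is constant along the lag and yields a Riemann sum of \<open>K u * cos (\<omega> * u)\<close>, plus half
  the cosine of the sum, which oscillates. The oscillating sums are of order \<open>1 / h n\<close> and contribute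
  \<open>O (1 / (n * h n))\<close>, the diagonal contributes \<open>O (h n)\<close>. The phase \<open>\<phi>\<close>
  occurs in these two vanishing parts only.\<close>

lemma quadratic_form_of_sampled_cosine_tendsto:
  fixes K :: "real \<Rightarrow> real" and h :: "nat \<Rightarrow> real"
  assumes K: "\<And>u. u \<ge> 0 \<Longrightarrow> K u \<ge> 0" "\<And>u v. 0 \<le> u \<Longrightarrow> u \<le> v \<Longrightarrow> K v \<le> K u"
      "continuous_on {0..} K" "set_integrable lborel {0..} K"
    and h: "\<And>n. n \<ge> 1 \<Longrightarrow> h n > 0" "h \<longlonglongrightarrow> 0" "filterlim (\<lambda>n. real n * h n) at_top sequentially"
    and w: "\<omega> > 0"
  shows "(\<lambda>n. h n / real n * (\<Sum>i=1..n. \<Sum>j=1..n. cos (\<omega> * (real i * h n) + \<phi>) * cos (\<omega> * (real j * h n) + \<phi>)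
            * K \<bar>real i * h n - real j * h n\<bar>)) \<longlonglongrightarrow> (LBINT u:{0..}. K u * cos (\<omega> * u))"
    (is "?Q \<longlonglongrightarrow> ?C")
proof -
  define I where "I = (LBINT u:{0..}. K u)"
  define main where "main n = (\<Sum>k=1..n. h n * ((1 - real k / real n) * (K (real k * h n) * cos (\<omega> * (real k * h n)))))" for n
  have main: "main \<longlonglongrightarrow> ?C"
    unfolding main_def
  proof (rule weighted_riemann_sum_tendsto[OF K h])
    show "continuous_on {0..} (\<lambda>u. K u * cos (\<omega> * u))" by (intro continuous_intros K)
    show "\<bar>K u * cos (\<omega> * u)\<bar> \<le> K u" if "u \<ge> 0" for u
      using mult_left_mono[OF abs_cos_le_one[of "\<omega> * u"] K(1)[OF that]] K(1)[OF that] by (simp add: abs_mult)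
  qed
  have bound: "\<bar>?Q n - main n\<bar> \<le> h n * K 0 + 2 * I / \<omega> / (real n * h n)"
    if n: "n \<ge> 1" and sin: "\<omega> * h n / 2 \<le> sin (\<omega> * h n)" for n
  proof -
    define H where "H = h n"
    have H: "H > 0" using h(1)[OF n] by (simp add: H_def)
    define c where "c i = cos (\<omega> * (real i * H) + \<phi>)" for i
    define F where "F i j = c i * c j * K \<bar>real i * H - real j * H\<bar>" for i j
    define S where "S k = (\<Sum>i=1..n-k. cos (2 * real i * (\<omega> * H) + (\<omega> * (real k * H) + 2 * \<phi>)))" for k
    have lag: "2 * (\<Sum>i=1..n-k. F i (i + k)) = K (real k * H) * (real (n - k) * cos (\<omega> * (real k * H)) + S k)" for k
    proof -
      have "2 * F i (i + k) = K (real k * H) * (cos (\<omega> * (real k * H)) + cos (2 * real i * (\<omega> * H) + (\<omega> * (real k * H) + 2 * \<phi>)))" for i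
      proof -
        have "\<bar>real i * H - real (i + k) * H\<bar> = real k * H" using H by (simp add: ring_distribs)
        moreover have "2 * (c (i + k) * c i) = cos (\<omega> * (real k * H)) + cos (2 * real i * (\<omega> * H) + (\<omega> * (real k * H) + 2 * \<phi>))"
          unfolding c_def cos_times_cos by (simp add: algebra_simps)
        moreover have "2 * F i (i + k) = K \<bar>real i * H - real (i + k) * H\<bar> * (2 * (c (i + k) * c i))"
          unfolding F_def by simp
        ultimately show ?thesis by simp
      qed
      then have "2 * (\<Sum>i=1..n-k. F i (i + k)) = (\<Sum>i=1..n-k. K (real k * H) * (cos (\<omega> * (real k * H)) + cos (2 * real i * (\<omega> * H) + (\<omega> * (real k * H) + 2 * \<phi>))))"
        by (simp only: sum_distrib_left)
      then show ?thesis by (simp add: S_def sum.distrib flip: sum_distrib_left)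
    qed
    have S: "\<bar>S k\<bar> \<le> 2 / (\<omega> * H)" for k
    proof -
      have pos: "0 < \<omega> * H / 2" and le: "\<omega> * H / 2 \<le> sin (\<omega> * H)"
        using w H sin by (simp_all add: H_def)
      have "\<bar>S k\<bar> \<le> 1 / sin (\<omega> * H)"
        unfolding S_def by (rule abs_sum_cos_le) (rule less_le_trans[OF pos le])
      also have "\<dots> \<le> 1 / (\<omega> * H / 2)"
        using pos le by (intro divide_left_mono mult_pos_pos less_le_trans[OF pos le]) auto
      finally show ?thesis by simp
    qed
    have sym: "F i j = F j i" for i j
      unfolding F_def by (simp add: abs_minus_commute mult.commute)
    have "?Q n = H / real n * (\<Sum>i=1..n. \<Sum>j=1..n. F i j)"
      unfolding F_def c_def H_def ..
    also have "(\<Sum>i=1..n. \<Sum>j=1..n. F i j) = (\<Sum>i=1..n. F i i) + 2 * (\<Sum>k=1..n. \<Sum>i=1..n-k. F i (i + k))"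
      by (rule double_sum_by_lag[OF sym])
    also have "H / real n * ((\<Sum>i=1..n. F i i) + 2 * (\<Sum>k=1..n. \<Sum>i=1..n-k. F i (i + k))) = H / real n * (\<Sum>i=1..n. F i i) + main n + H / real n * (\<Sum>k=1..n. K (real k * H) * S k)"
    proof -
      have "2 * (\<Sum>k=1..n. \<Sum>i=1..n-k. F i (i + k)) = (\<Sum>k=1..n. K (real k * H) * (real (n - k) * cos (\<omega> * (real k * H)) + S k))"
        unfolding lag[symmetric] by (simp add: sum_distrib_left)
      also have "\<dots> = (\<Sum>k=1..n. K (real k * H) * (real (n - k) * cos (\<omega> * (real k * H)))) + (\<Sum>k=1..n. K (real k * H) * S k)"
        by (simp add: ring_distribs sum.distrib)
      finally have 1: "2 * (\<Sum>k=1..n. \<Sum>i=1..n-k. F i (i + k)) = \<dots>" .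
      have 2: "H / real n * (\<Sum>k=1..n. K (real k * H) * (real (n - k) * cos (\<omega> * (real k * H)))) = main n"
        unfolding main_def sum_distrib_left H_def[symmetric]
      proof (intro sum.cong refl)
        fix k assume "k \<in> {1..n}"
        then have "real (n - k) / real n = 1 - real k / real n" using n by (simp add: of_nat_diff field_simps)
        then show "H / real n * (K (real k * H) * (real (n - k) * cos (\<omega> * (real k * H)))) 
           = H * ((1 - real k / real n) * (K (real k * H) * cos (\<omega> * (real k * H))))"
          by (simp flip: \<open>real (n - k) / real n = 1 - real k / real n\<close>)
      qed
      show ?thesis unfolding 1 using 2 by (simp add: ring_distribs)
    qed
    finally have eq: "?Q n - main n = H / real n * (\<Sum>i=1..n. F i i) + H / real n * (\<Sum>k=1..n. K (real k * H) * S k)" by simp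
    have "\<bar>\<Sum>i=1..n. F i i\<bar> \<le> (\<Sum>i=1..n. K 0)"
    proof (intro order.trans[OF sum_abs] sum_mono)
      fix i
      have "\<bar>c i\<bar> * \<bar>c i\<bar> \<le> 1" unfolding c_def by (intro mult_le_one) auto
      then have "\<bar>c i\<bar> * \<bar>c i\<bar> * K 0 \<le> 1 * K 0" using K(1)[of 0] by (intro mult_right_mono) auto
      then show "\<bar>F i i\<bar> \<le> K 0" using K(1)[of 0] by (simp add: F_def abs_mult)
    qed
    then have "H / real n * \<bar>\<Sum>i=1..n. F i i\<bar> \<le> H / real n * (real n * K 0)"
      using H by (intro mult_left_mono) auto
    then have b1: "H / real n * \<bar>\<Sum>i=1..n. F i i\<bar> \<le> H * K 0" using n by simp
    have "\<bar>\<Sum>k=1..n. K (real k * H) * S k\<bar> \<le> (\<Sum>k=1..n. K (real k * H) * (2 / (\<omega> * H)))"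
    proof (intro order.trans[OF sum_abs] sum_mono)
      fix k
      have "K (real k * H) \<ge> 0" using H by (intro K(1)) auto
      then show "\<bar>K (real k * H) * S k\<bar> \<le> K (real k * H) * (2 / (\<omega> * H))"
        using S[of k] by (simp only: abs_mult abs_of_nonneg mult_left_mono)
    qed
    also have "\<dots> = (\<Sum>k=1..n. H * K (real k * H)) * (2 / (\<omega> * H\<^sup>2))"
      unfolding sum_distrib_right using H w by (intro sum.cong refl) (simp add: power2_eq_square)
    also have "\<dots> \<le> I * (2 / (\<omega> * H\<^sup>2))"
      unfolding I_def using H w by (intro mult_right_mono riemann_sum_le_integral[OF K H]) auto
    finally have "H / real n * \<bar>\<Sum>k=1..n. K (real k * H) * S k\<bar> \<le> H / real n * (I * (2 / (\<omega> * H\<^sup>2)))"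
      using H by (intro mult_left_mono) auto
    also have "\<dots> = 2 * I / \<omega> / (real n * H)"
      using H n w by (simp add: power2_eq_square field_simps)
    finally have b2: "H / real n * \<bar>\<Sum>k=1..n. K (real k * H) * S k\<bar> \<le> 2 * I / \<omega> / (real n * H)" .
    have "\<bar>?Q n - main n\<bar> \<le> \<bar>H / real n * (\<Sum>i=1..n. F i i)\<bar> + \<bar>H / real n * (\<Sum>k=1..n. K (real k * H) * S k)\<bar>"
      unfolding eq by (rule abs_triangle_ineq)
    also have "\<dots> = H / real n * \<bar>\<Sum>i=1..n. F i i\<bar> + H / real n * \<bar>\<Sum>k=1..n. K (real k * H) * S k\<bar>"
      using H by (simp add: abs_mult)
    finally show ?thesis using b1 b2 unfolding H_def by linarith
  qed
  have "(\<lambda>n. ?Q n - main n) \<longlonglongrightarrow> 0"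
  proof (rule Lim_null_comparison)
    show "\<forall>\<^sub>F n in sequentially. norm (?Q n - main n) \<le> h n * K 0 + 2 * I / \<omega> / (real n * h n)"
      using eventually_conj[OF sin_step_asymptotics[OF h(1,2) w] eventually_ge_at_top[of "1::nat"]]
      by (rule eventually_mono) (use bound in auto)
    have "(\<lambda>n. h n * K 0 + 2 * I / \<omega> / (real n * h n)) \<longlonglongrightarrow> 0 * K 0 + 0"
      by (intro tendsto_add tendsto_mult h(2) tendsto_const real_tendsto_divide_at_top[OF tendsto_const h(3)])
    then show "(\<lambda>n. h n * K 0 + 2 * I / \<omega> / (real n * h n)) \<longlonglongrightarrow> 0" by simp
  qed
  from tendsto_add[OF this main] show ?thesis by simp
qed

text \<open>The transform is evaluated with an explicit antiderivative \<open>G\<close> of \<open>exp (- b * u) * cos (\<omega> * u)\<close>.\<close>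

lemma ou_kernel_properties:
  assumes "a > 0" "b > 0"
  shows "ou_kernel a b u \<ge> 0" "0 \<le> u \<Longrightarrow> u \<le> v \<Longrightarrow> ou_kernel a b v \<le> ou_kernel a b u"
    and "continuous_on A (ou_kernel a b)" "set_integrable lborel {0..} (ou_kernel a b)"
    and "cos_transform (ou_kernel a b) \<omega> = a * b / (b\<^sup>2 + \<omega>\<^sup>2)"
proof -
  show "ou_kernel a b u \<ge> 0" using assms by (simp add: ou_kernel_def)
  show "ou_kernel a b v \<le> ou_kernel a b u" if "0 \<le> u" "u \<le> v"
    using assms that by (simp add: ou_kernel_def)
  show "continuous_on A (ou_kernel a b)" unfolding ou_kernel_def by (intro continuous_intros)
  define f where "f u = a * exp (- b * u)" for u
  define F where "F u = - (a / b) * exp (- b * u)" for u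
  define G where "G u = a * exp (- b * u) * (\<omega> * sin (\<omega> * u) - b * cos (\<omega> * u)) / (b\<^sup>2 + \<omega>\<^sup>2)" for u
  have e0: "((\<lambda>x. exp (- b * x)) \<longlongrightarrow> 0) at_top"
    using assms by (intro filterlim_compose[OF exp_at_bot] filterlim_tendsto_neg_mult_at_bot[OF tendsto_const _ filterlim_ident]) auto
  have "set_integrable lborel (einterval 0 \<infinity>) f"
  proof (rule interval_integral_FTC_nonneg(1)[where F=F and A="- (a / b)" and B=0])
    show "(F has_real_derivative f x) (at x)" for x
      unfolding F_def f_def using assms by (auto intro!: derivative_eq_intros)
    show "isCont f x" for x unfolding f_def by (intro continuous_intros)
    show "AE x in lborel. 0 < ereal x \<longrightarrow> ereal x < \<infinity> \<longrightarrow> 0 \<le> f x" using assms by (simp add: f_def)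
    have "(F \<longlongrightarrow> F 0) (at_right 0)"
      unfolding F_def by (intro tendsto_intros)
    then show "((F \<circ> real_of_ereal) \<longlongrightarrow> - (a / b)) (at_right 0)"
      by (simp add: zero_ereal_def ereal_tendsto_simps1 F_def)
    have "(F \<longlongrightarrow> - (a / b) * 0) at_top" unfolding F_def by (intro tendsto_mult tendsto_const e0)
    then show "((F \<circ> real_of_ereal) \<longlongrightarrow> 0) (at_left \<infinity>)"
      by (simp add: ereal_tendsto_simps1)
  qed simp
  then have int0: "set_integrable lborel {0<..} f" by (simp add: zero_ereal_def)
  have AE0: "AE u in lborel. (u \<in> {0<..}) = (u \<in> {0::real..})"
    using AE_lborel_singleton[of 0] by eventually_elim auto
  show int: "set_integrable lborel {0..} (ou_kernel a b)"
  proof -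
    have "AE u in lborel. indicator {0..} u *\<^sub>R f u = indicator {0<..} u *\<^sub>R f u"
      using AE0 by eventually_elim (simp add: indicator_def)
    then have "integrable lborel (\<lambda>u. indicator {0..} u *\<^sub>R f u) = integrable lborel (\<lambda>u. indicator {0<..} u *\<^sub>R f u)"
      by (intro integrable_cong_AE) (auto simp: f_def)
    then have "set_integrable lborel {0..} f"
      using int0 unfolding set_integrable_def by simp
    then show ?thesis by (rule set_integrable_cong[THEN iffD1, rotated -1]) (auto simp: f_def ou_kernel_def)
  qed
  have sI: "set_integrable lborel {0<..} (\<lambda>u. f u * cos (\<omega> * u))"
  proof (rule set_integrable_bound[OF int0])
    show "set_borel_measurable lborel {0<..} (\<lambda>u. f u * cos (\<omega> * u))"
      unfolding f_def set_borel_measurable_def by measurable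
    show "AE x in lborel. x \<in> {0<..} \<longrightarrow> norm (f x * cos (\<omega> * x)) \<le> norm (f x)"
      by (auto simp: abs_mult intro!: mult_left_le)
  qed
  have bw: "b\<^sup>2 + \<omega>\<^sup>2 > 0" using assms by (simp add: add_pos_nonneg)
  have "(LBINT u=0..\<infinity>. f u * cos (\<omega> * u)) = 0 - G 0"
  proof (rule interval_integral_FTC_integrable)
    show "(G has_vector_derivative f x * cos (\<omega> * x)) (at x)" for x
    proof -
      have "(G has_real_derivative (a * (exp (- b * x) * - b) * (\<omega> * sin (\<omega> * x) - b * cos (\<omega> * x)) 
           + a * exp (- b * x) * (\<omega> * (cos (\<omega> * x) * \<omega>) + b * (sin (\<omega> * x) * \<omega>))) / (b\<^sup>2 + \<omega>\<^sup>2)) (at x)"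
        unfolding G_def using bw by (auto intro!: derivative_eq_intros)
      also have "(a * (exp (- b * x) * - b) * (\<omega> * sin (\<omega> * x) - b * cos (\<omega> * x)) 
           + a * exp (- b * x) * (\<omega> * (cos (\<omega> * x) * \<omega>) + b * (sin (\<omega> * x) * \<omega>))) 
         = (b\<^sup>2 + \<omega>\<^sup>2) * (f x * cos (\<omega> * x))"
        by (simp add: f_def algebra_simps power2_eq_square)
      also have "(b\<^sup>2 + \<omega>\<^sup>2) * (f x * cos (\<omega> * x)) / (b\<^sup>2 + \<omega>\<^sup>2) = f x * cos (\<omega> * x)"
        using bw by (intro nonzero_mult_div_cancel_left less_imp_neq[symmetric])
      finally show ?thesis by (simp only: has_real_derivative_iff_has_vector_derivative)
    qed
    show "isCont (\<lambda>u. f u * cos (\<omega> * u)) x" for x unfolding f_def by (intro continuous_intros)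
    show "set_integrable lborel (einterval 0 \<infinity>) (\<lambda>u. f u * cos (\<omega> * u))" using sI by (simp add: zero_ereal_def)
    have "(G \<longlongrightarrow> G 0) (at_right 0)" unfolding G_def using bw by (intro tendsto_intros) auto
    then show "((G \<circ> real_of_ereal) \<longlongrightarrow> G 0) (at_right 0)"
      by (simp add: zero_ereal_def ereal_tendsto_simps1)
    have "(G \<longlongrightarrow> 0) at_top"
    proof (rule Lim_null_comparison)
      have "norm (G x) \<le> a * (\<bar>\<omega>\<bar> + b) / (b\<^sup>2 + \<omega>\<^sup>2) * exp (- b * x)" for x
      proof -
        have "\<bar>\<omega> * sin (\<omega> * x) - b * cos (\<omega> * x)\<bar> \<le> \<bar>\<omega>\<bar> * 1 + b * 1"
          using assms by (intro order.trans[OF abs_triangle_ineq4] add_mono) (auto simp: abs_mult intro!: mult_left_le)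
        then have "a * exp (- b * x) * \<bar>\<omega> * sin (\<omega> * x) - b * cos (\<omega> * x)\<bar> / (b\<^sup>2 + \<omega>\<^sup>2) 
            \<le> a * exp (- b * x) * (\<bar>\<omega>\<bar> + b) / (b\<^sup>2 + \<omega>\<^sup>2)"
          using assms bw by (intro divide_right_mono mult_left_mono) auto
        then show ?thesis using assms bw by (simp add: G_def abs_mult mult_ac)
      qed
      then show "\<forall>\<^sub>F x in at_top. norm (G x) \<le> a * (\<bar>\<omega>\<bar> + b) / (b\<^sup>2 + \<omega>\<^sup>2) * exp (- b * x)" by simp
      show "((\<lambda>x. a * (\<bar>\<omega>\<bar> + b) / (b\<^sup>2 + \<omega>\<^sup>2) * exp (- b * x)) \<longlongrightarrow> 0) at_top"
        by (rule tendsto_mult_right_zero[OF e0])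
    qed
    then show "((G \<circ> real_of_ereal) \<longlongrightarrow> 0) (at_left \<infinity>)" by (simp add: ereal_tendsto_simps1)
  qed simp
  then have val: "(LBINT u:{0<..}. f u * cos (\<omega> * u)) = a * b / (b\<^sup>2 + \<omega>\<^sup>2)"
    by (simp add: interval_integral_to_infinity_eq zero_ereal_def G_def)
  have "cos_transform (ou_kernel a b) \<omega> = (LBINT u:{0..}. f u * cos (\<omega> * u))"
    unfolding cos_transform_def by (rule set_lebesgue_integral_cong) (auto simp: f_def ou_kernel_def)
  also have "\<dots> = (LBINT u:{0<..}. f u * cos (\<omega> * u))"
    by (rule set_integral_cong_set) (use AE0 in \<open>auto simp: f_def set_borel_measurable_def\<close>)
  finally show "cos_transform (ou_kernel a b) \<omega> = a * b / (b\<^sup>2 + \<omega>\<^sup>2)" using val by simp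
qed

text \<open>The kernel is a multiple of the density of the normal law with variance \<open>1 / b\<close>. The transform over
  the whole line is therefore a value of a normal characteristic function, and by symmetry the half-line
  carries half of it.\<close>

lemma gaussian_kernel_properties:
  assumes "a > 0" "b > 0"
  shows "gaussian_kernel a b u \<ge> 0" "0 \<le> u \<Longrightarrow> u \<le> v \<Longrightarrow> gaussian_kernel a b v \<le> gaussian_kernel a b u"
    and "continuous_on A (gaussian_kernel a b)" "set_integrable lborel {0..} (gaussian_kernel a b)"
    and "cos_transform (gaussian_kernel a b) \<omega> = a * sqrt (pi / (2 * b)) * exp (- \<omega>\<^sup>2 / (2 * b))"
proof -
  show "gaussian_kernel a b u \<ge> 0" using assms by (simp add: gaussian_kernel_def)
  show "gaussian_kernel a b v \<le> gaussian_kernel a b u" if "0 \<le> u" "u \<le> v"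
    using assms that by (simp add: gaussian_kernel_def power_mono)
  show "continuous_on A (gaussian_kernel a b)" unfolding gaussian_kernel_def by (intro continuous_intros) auto
  define d where "d = normal_density 0 (sqrt (1 / b))"
  define c where "c = a * sqrt (2 * pi / b)"
  have kd: "gaussian_kernel a b u = c * d u" for u
    using assms by (simp add: gaussian_kernel_def d_def c_def normal_density_def real_sqrt_divide real_sqrt_mult power_divide field_simps)
  have di: "integrable lborel d" using assms by (simp add: d_def)
  have dci: "integrable lborel (\<lambda>u. d u * cos (\<omega> * u))"
    by (rule Bochner_Integration.integrable_bound[OF di]) (auto simp: abs_mult d_def intro!: mult_left_le)
  show "set_integrable lborel {0..} (gaussian_kernel a b)"
    unfolding kd[abs_def] set_integrable_def using di by (intro integrable_mult_indicator) auto
  have "complex_of_real (\<integral>u. d u * cos (\<omega> * u) \<partial>lborel) = of_real (Re (\<integral>u. d u *\<^sub>R iexp (\<omega> * u) \<partial>lborel))"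
  proof -
    have "integrable lborel (\<lambda>u. d u *\<^sub>R iexp (\<omega> * u))"
      by (rule Bochner_Integration.integrable_bound[OF di]) (auto simp: d_def)
    then show ?thesis by (simp add: Re_exp flip: integral_Re)
  qed
  also have "(\<integral>u. d u *\<^sub>R iexp (\<omega> * u) \<partial>lborel) = (\<integral>u. iexp (\<omega> * u) \<partial>density lborel d)"
    by (subst integral_density) (auto simp: d_def)
  also have "\<dots> = exp (- \<omega>\<^sup>2 / (2 * b))"
    unfolding d_def using assms by (subst char_normal_density) auto
  finally have "(\<integral>u. d u * cos (\<omega> * u) \<partial>lborel) = exp (- \<omega>\<^sup>2 / (2 * b))" by simp
  moreover have "has_bochner_integral lborel (\<lambda>u. d u * cos (\<omega> * u)) (2 *\<^sub>R (LBINT u:{0..}. d u * cos (\<omega> * u)))"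
    unfolding set_lebesgue_integral_def
  proof (rule has_bochner_integral_even_function)
    show "has_bochner_integral lborel (\<lambda>x. indicator {0..} x *\<^sub>R (d x * cos (\<omega> * x))) (\<integral>x. indicator {0..} x *\<^sub>R (d x * cos (\<omega> * x)) \<partial>lborel)"
      using dci by (intro has_bochner_integral_integrable integrable_mult_indicator) auto
  qed (simp add: d_def normal_density_def)
  ultimately have half: "(LBINT u:{0..}. d u * cos (\<omega> * u)) = exp (- \<omega>\<^sup>2 / (2 * b)) / 2"
    by (simp add: has_bochner_integral_iff)
  have "cos_transform (gaussian_kernel a b) \<omega> = c * (LBINT u:{0..}. d u * cos (\<omega> * u))"
    unfolding cos_transform_def kd by (simp add: mult.assoc)
  also have "\<dots> = a * (sqrt (2 * pi / b) / 2) * exp (- \<omega>\<^sup>2 / (2 * b))"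
    by (simp add: half c_def)
  also have "sqrt (2 * pi / b) / 2 = sqrt (pi / (2 * b))"
    using assms by (intro real_sqrt_unique[symmetric]) (auto simp: power_divide)
  finally show "cos_transform (gaussian_kernel a b) \<omega> = a * sqrt (pi / (2 * b)) * exp (- \<omega>\<^sup>2 / (2 * b))" .
qed

section \<open>The least-squares contrast\<close>

text \<open>The drift is linear in the parameter, \<open>periodic_drift \<omega> \<xi> t = \<xi> \<bullet> regressor \<omega> t\<close>, so the contrast is
  a quadratic function of the parameter.\<close>

definition regressor :: "real \<Rightarrow> real \<Rightarrow> real ^ 2" where
  "regressor \<omega> t = vector [sin (\<omega> * t), cos (\<omega> * t)]"

definition regressor_deriv :: "real \<Rightarrow> real \<Rightarrow> real ^ 2" where
  "regressor_deriv \<omega> t = vector [\<omega> * cos (\<omega> * t), - (\<omega> * sin (\<omega> * t))]"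

lemma periodic_drift_eq_inner: "periodic_drift \<omega> \<xi> t = \<xi> \<bullet> regressor \<omega> t"
  by (simp add: periodic_drift_def regressor_def inner_vec_def sum_2)

lemma norm_regressor [simp]: "norm (regressor \<omega> t) = 1"
  by (simp add: norm_vec_def L2_set_def regressor_def sum_2)

text \<open>Every projection of the regressor is a single cosine with a phase. Estimates for vectors are obtained
  from scalar trigonometry through this representation.\<close>

lemma inner_regressor_polar:
  obtains \<phi> where "\<And>t. s \<bullet> regressor \<omega> t = norm s * cos (\<omega> * t + \<phi>)"
    and "\<And>t. s \<bullet> regressor_deriv \<omega> t = - \<omega> * norm s * sin (\<omega> * t + \<phi>)"
proof -
  have n: "sqrt ((s $ 2)\<^sup>2 + (s $ 1)\<^sup>2) = norm s"
    by (simp add: norm_vec_def L2_set_def sum_2 add.commute)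
  obtain \<phi> where \<phi>: "\<And>t. s $ 2 * cos t + s $ 1 * sin t = norm s * cos (t + \<phi>)"
    using polar_form[of "s $ 2" "s $ 1"] unfolding n by blast
  have "s \<bullet> regressor \<omega> t = norm s * cos (\<omega> * t + \<phi>)" for t
    using \<phi>[of "\<omega> * t"] by (simp add: regressor_def inner_vec_def sum_2)
  moreover have "s \<bullet> regressor_deriv \<omega> t = - \<omega> * norm s * sin (\<omega> * t + \<phi>)" for t
  proof -
    have "s $ 1 * cos (\<omega> * t) - s $ 2 * sin (\<omega> * t) = norm s * cos (\<omega> * t + \<phi> + pi / 2)"
      using \<phi>[of "\<omega> * t + pi / 2"] by (simp add: sin_add cos_add add_ac)
    also have "\<dots> = - norm s * sin (\<omega> * t + \<phi>)" by (simp add: cos_add)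
    finally have "\<omega> * (s $ 1 * cos (\<omega> * t) - s $ 2 * sin (\<omega> * t)) = - \<omega> * norm s * sin (\<omega> * t + \<phi>)"
      by simp
    then show ?thesis
      by (simp add: regressor_deriv_def inner_vec_def sum_2 algebra_simps)
  qed
  ultimately show ?thesis by (rule that)
qed

text \<open>Testing a vector against itself turns a scalar bound into a bound of its norm.\<close>

lemma norm_le_if_inner_le:
  fixes v :: "'a::real_inner"
  assumes "\<bar>v \<bullet> v\<bar> \<le> norm v * C" "C \<ge> 0"
  shows "norm v \<le> C"
proof (cases "v = 0")
  case False
  have "norm v * norm v \<le> norm v * C" using assms by (simp add: dot_square_norm power2_eq_square)
  with False show ?thesis by simp
qed (use assms in simp)

lemma abs_sin_diff_le: "\<bar>sin x - sin y\<bar> \<le> \<bar>x - y\<bar>" for x y :: real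
proof -
  have "\<bar>sin x - sin y\<bar> \<le> 1 * \<bar>x - y\<bar>"
    using field_differentiable_bound[of UNIV sin cos 1 x y]
    by (auto intro: DERIV_subset DERIV_sin)
  then show ?thesis by simp
qed

lemma abs_cos_diff_le: "\<bar>cos x - cos y\<bar> \<le> \<bar>x - y\<bar>" for x y :: real
  using abs_sin_diff_le[of "x + pi / 2" "y + pi / 2"] by (simp add: sin_add)

lemma cos_linearization: "\<bar>cos x - cos y + (x - y) * sin x\<bar> \<le> (x - y)\<^sup>2" for x y :: real
proof -
  have "\<bar>cos x - cos y + (x - y) * sin x\<bar> \<le> \<bar>x - y\<bar> * \<bar>x - y\<bar>"
  proof -
    have d: "((\<lambda>z. cos z + z * sin x) has_field_derivative (sin x - sin z)) (at z within closed_segment x y)" for z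
      by (auto intro!: derivative_eq_intros)
    have "norm ((cos x + x * sin x) - (cos y + y * sin x)) \<le> \<bar>x - y\<bar> * norm (x - y)"
    proof (rule field_differentiable_bound[OF convex_closed_segment d])
      fix z assume "z \<in> closed_segment x y"
      then have "\<bar>x - z\<bar> \<le> \<bar>x - y\<bar>" by (auto simp: closed_segment_eq_real_ivl split: if_splits)
      then show "norm (sin x - sin z) \<le> \<bar>x - y\<bar>" using abs_sin_diff_le[of x z] by simp
    qed auto
    then show ?thesis by (simp add: algebra_simps)
  qed
  then show ?thesis by (simp add: power2_eq_square flip: abs_mult)
qed

lemma regressor_linearization:
  "norm (regressor \<omega> t - regressor \<omega> s - (t - s) *\<^sub>R regressor_deriv \<omega> t) \<le> (\<omega> * (t - s))\<^sup>2"
    (is "norm ?v \<le> _")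
proof (rule norm_le_if_inner_le)
  obtain \<phi> where \<phi>: "\<And>t. ?v \<bullet> regressor \<omega> t = norm ?v * cos (\<omega> * t + \<phi>)"
    "\<And>t. ?v \<bullet> regressor_deriv \<omega> t = - \<omega> * norm ?v * sin (\<omega> * t + \<phi>)"
    using inner_regressor_polar[of ?v \<omega>] by blast
  define N where "N = norm ?v"
  have "?v \<bullet> ?v = ?v \<bullet> regressor \<omega> t - ?v \<bullet> regressor \<omega> s - (t - s) * (?v \<bullet> regressor_deriv \<omega> t)"
    by (simp only: inner_diff_right[of ?v] inner_scaleR_right)
  also have "\<dots> = N * (cos (\<omega> * t + \<phi>) - cos (\<omega> * s + \<phi>) + (\<omega> * t + \<phi> - (\<omega> * s + \<phi>)) * sin (\<omega> * t + \<phi>))"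
    unfolding \<phi> N_def[symmetric] by (simp add: algebra_simps)
  finally have "\<bar>?v \<bullet> ?v\<bar> = N * \<bar>cos (\<omega> * t + \<phi>) - cos (\<omega> * s + \<phi>) + (\<omega> * t + \<phi> - (\<omega> * s + \<phi>)) * sin (\<omega> * t + \<phi>)\<bar>"
    by (simp add: abs_mult N_def)
  also have "\<dots> \<le> N * (\<omega> * t + \<phi> - (\<omega> * s + \<phi>))\<^sup>2"
    by (intro mult_left_mono cos_linearization) (simp add: N_def)
  also have "(\<omega> * t + \<phi> - (\<omega> * s + \<phi>))\<^sup>2 = (\<omega> * (t - s))\<^sup>2" by (simp add: right_diff_distrib)
  finally show "\<bar>?v \<bullet> ?v\<bar> \<le> norm ?v * (\<omega> * (t - s))\<^sup>2" unfolding N_def .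
qed simp

lemma abs_drift_diff_le: "\<bar>periodic_drift \<omega> \<xi> t - periodic_drift \<omega> \<xi> s\<bar> \<le> norm \<xi> * \<bar>\<omega> * (t - s)\<bar>"
proof -
  obtain \<phi> where \<phi>: "\<And>t. \<xi> \<bullet> regressor \<omega> t = norm \<xi> * cos (\<omega> * t + \<phi>)"
    using inner_regressor_polar by blast
  have "\<bar>cos (\<omega> * t + \<phi>) - cos (\<omega> * s + \<phi>)\<bar> \<le> \<bar>\<omega> * (t - s)\<bar>"
    using abs_cos_diff_le[of "\<omega> * t + \<phi>" "\<omega> * s + \<phi>"] by (simp add: right_diff_distrib)
  then show ?thesis unfolding periodic_drift_eq_inner \<phi> right_diff_distrib[symmetric] abs_mult[of "norm \<xi>"]
    by (simp add: mult_left_mono)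
qed

lemma drift_increment_error:
  assumes "0 \<le> s" "s \<le> t"
  shows "\<bar>(LBINT u:{0..t}. periodic_drift \<omega> \<xi> u) - (LBINT u:{0..s}. periodic_drift \<omega> \<xi> u) - periodic_drift \<omega> \<xi> s * (t - s)\<bar>
    \<le> norm \<xi> * \<bar>\<omega>\<bar> * (t - s)\<^sup>2"
proof -
  let ?\<mu> = "periodic_drift \<omega> \<xi>"
  have c: "continuous_on A ?\<mu>" for A unfolding periodic_drift_def by (intro continuous_intros)
  have i: "set_integrable lborel {p..q} ?\<mu>" for p q
    by (rule borel_integrable_atLeastAtMost') (rule c)
  have i': "set_integrable lborel {p<..q} ?\<mu>" "set_integrable lborel {p<..q} (\<lambda>u. r)" for p q r :: real
  proof -
    show "set_integrable lborel {p<..q} ?\<mu>" by (rule set_integrable_subset[OF i[of p q]]) auto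
    have "set_integrable lborel {p..q} (\<lambda>u. r)" by (rule borel_integrable_atLeastAtMost') simp
    then show "set_integrable lborel {p<..q} (\<lambda>u. r)" by (rule set_integrable_subset) auto
  qed
  have "(LBINT u:{0..t}. ?\<mu> u) = (LBINT u:{0..s} \<union> {s<..t}. ?\<mu> u)"
    using assms by (simp add: ivl_disj_un)
  also have "\<dots> = (LBINT u:{0..s}. ?\<mu> u) + (LBINT u:{s<..t}. ?\<mu> u)"
    by (rule set_integral_Un[OF _ i i'(1)]) auto
  finally have "(LBINT u:{0..t}. ?\<mu> u) - (LBINT u:{0..s}. ?\<mu> u) - ?\<mu> s * (t - s) = (LBINT u:{s<..t}. ?\<mu> u) - ?\<mu> s * (t - s)"
    by simp
  also have const: "?\<mu> s * (t - s) = (LBINT u:{s<..t}. ?\<mu> s)"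
    using assms by (subst set_integral_const) auto
  also have "(LBINT u:{s<..t}. ?\<mu> u) - (LBINT u:{s<..t}. ?\<mu> s) = (LBINT u:{s<..t}. ?\<mu> u - ?\<mu> s)"
    by (rule set_integral_diff(2)[OF i', symmetric])
  also have "\<bar>\<dots>\<bar> \<le> (LBINT u:{s<..t}. norm \<xi> * \<bar>\<omega>\<bar> * (t - s))"
  proof -
    have "\<bar>LBINT u:{s<..t}. ?\<mu> u - ?\<mu> s\<bar> \<le> (LBINT u:{s<..t}. \<bar>?\<mu> u - ?\<mu> s\<bar>)"
      using set_integral_norm_bound[OF set_integral_diff(1)[OF i', of s t]] by simp
    also have "\<dots> \<le> (LBINT u:{s<..t}. norm \<xi> * \<bar>\<omega>\<bar> * (t - s))"
    proof (rule set_integral_mono)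
      show "set_integrable lborel {s<..t} (\<lambda>u. \<bar>?\<mu> u - ?\<mu> s\<bar>)"
        by (rule set_integrable_abs[OF set_integral_diff(1)[OF i']])
      show "set_integrable lborel {s<..t} (\<lambda>u. norm \<xi> * \<bar>\<omega>\<bar> * (t - s))" by (rule i')
      fix u assume "u \<in> {s<..t}"
      then show "\<bar>?\<mu> u - ?\<mu> s\<bar> \<le> norm \<xi> * \<bar>\<omega>\<bar> * (t - s)"
        by (intro order.trans[OF abs_drift_diff_le]) (auto simp: abs_mult mult.assoc intro!: mult_left_mono)
    qed
    finally show ?thesis .
  qed
  also have "\<dots> = norm \<xi> * \<bar>\<omega>\<bar> * (t - s)\<^sup>2"
    using assms by (subst set_integral_const) (auto simp: power2_eq_square)
  finally show ?thesis unfolding const .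
qed

text \<open>The design matrix \<open>H * (\<Sum>i. g i (g i)\<^sup>T)\<close> equals \<open>T / 2\<close> times the identity up to an error that stays
  bounded as \<open>T\<close> grows: squaring the cosine of a projection gives its mean \<open>1 / 2\<close> and an oscillating sum.\<close>

lemma design_quadratic_form:
  assumes w: "\<omega> > 0" and H: "H > 0" and sin: "\<omega> * H / 2 \<le> sin (\<omega> * H)"
  shows "\<bar>H * (\<Sum>i=1..n. (\<eta> \<bullet> regressor \<omega> (real (i - 1) * H))\<^sup>2) - real n * H / 2 * (norm \<eta>)\<^sup>2\<bar> \<le> (norm \<eta>)\<^sup>2 / \<omega>"
proof -
  obtain \<phi> where \<phi>: "\<And>t. \<eta> \<bullet> regressor \<omega> t = norm \<eta> * cos (\<omega> * t + \<phi>)"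
    using inner_regressor_polar by blast
  define S where "S = (\<Sum>i=1..n. cos (2 * real i * (\<omega> * H) + (2 * \<phi> - 2 * (\<omega> * H))))"
  have pos: "0 < \<omega> * H / 2" using w H by simp
  have "\<bar>S\<bar> \<le> 1 / sin (\<omega> * H)"
    unfolding S_def by (rule abs_sum_cos_le) (rule less_le_trans[OF pos sin])
  also have "\<dots> \<le> 1 / (\<omega> * H / 2)"
    using pos sin by (intro divide_left_mono mult_pos_pos less_le_trans[OF pos sin]) auto
  finally have S: "\<bar>S\<bar> \<le> 2 / (\<omega> * H)" by simp
  have "(\<eta> \<bullet> regressor \<omega> (real (i - 1) * H))\<^sup>2 = (norm \<eta>)\<^sup>2 / 2 * (1 + cos (2 * real i * (\<omega> * H) + (2 * \<phi> - 2 * (\<omega> * H))))"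
    if "i \<in> {1..n}" for i
  proof -
    have "2 * real i * (\<omega> * H) + (2 * \<phi> - 2 * (\<omega> * H)) = 2 * (\<omega> * (real (i - 1) * H) + \<phi>)"
      using that by (simp add: of_nat_diff algebra_simps)
    then show ?thesis unfolding \<phi> cos_double_cos by (simp only: cos_double_cos) (simp add: power_mult_distrib)
  qed
  then have "(\<Sum>i=1..n. (\<eta> \<bullet> regressor \<omega> (real (i - 1) * H))\<^sup>2)
     = (\<Sum>i=1..n. (norm \<eta>)\<^sup>2 / 2 * (1 + cos (2 * real i * (\<omega> * H) + (2 * \<phi> - 2 * (\<omega> * H)))))"
    by (intro sum.cong refl)
  also have "\<dots> = (norm \<eta>)\<^sup>2 / 2 * (real n + S)"
    unfolding sum_distrib_left[symmetric] sum.distrib S_def by simp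
  finally have "(\<Sum>i=1..n. (\<eta> \<bullet> regressor \<omega> (real (i - 1) * H))\<^sup>2) = (norm \<eta>)\<^sup>2 / 2 * (real n + S)" .
  then have "H * (\<Sum>i=1..n. (\<eta> \<bullet> regressor \<omega> (real (i - 1) * H))\<^sup>2) - real n * H / 2 * (norm \<eta>)\<^sup>2 = H * (norm \<eta>)\<^sup>2 / 2 * S"
    by (simp add: algebra_simps)
  then have "\<bar>H * (\<Sum>i=1..n. (\<eta> \<bullet> regressor \<omega> (real (i - 1) * H))\<^sup>2) - real n * H / 2 * (norm \<eta>)\<^sup>2\<bar> = \<bar>H * (norm \<eta>)\<^sup>2 / 2 * S\<bar>"
    by (rule arg_cong)
  also have "\<dots> = H * (norm \<eta>)\<^sup>2 / 2 * \<bar>S\<bar>"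
    using H by (simp add: abs_mult)
  also have "\<dots> \<le> H * (norm \<eta>)\<^sup>2 / 2 * (2 / (\<omega> * H))"
    using H S by (intro mult_left_mono) auto
  also have "\<dots> = (norm \<eta>)\<^sup>2 / \<omega>" using H by simp
  finally show ?thesis .
qed

text \<open>Minus half the gradient of the contrast at \<open>\<xi>\<close>, divided by the step \<open>H\<close>.\<close>

definition score :: "real \<Rightarrow> real ^ 2 \<Rightarrow> nat \<Rightarrow> real \<Rightarrow> (real \<Rightarrow> real) \<Rightarrow> real ^ 2" where
  "score \<omega> \<xi> n H x = (\<Sum>i=1..n. (x (real i * H) - x (real (i - 1) * H) - periodic_drift \<omega> \<xi> (real (i - 1) * H) * H)
      *\<^sub>R regressor \<omega> (real (i - 1) * H))"

lemma contrast_expansion: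
  "contrast (periodic_drift \<omega>) n H x (\<xi> + \<eta>) = contrast (periodic_drift \<omega>) n H x \<xi>
     - 2 * H * (\<eta> \<bullet> score \<omega> \<xi> n H x) + H * (H * (\<Sum>i=1..n. (\<eta> \<bullet> regressor \<omega> (real (i - 1) * H))\<^sup>2))"
proof -
  have "contrast (periodic_drift \<omega>) n H x (\<xi> + \<eta>) = (\<Sum>i=1..n. 
      (x (real i * H) - x (real (i - 1) * H) - periodic_drift \<omega> \<xi> (real (i - 1) * H) * H)\<^sup>2
      - 2 * H * ((x (real i * H) - x (real (i - 1) * H) - periodic_drift \<omega> \<xi> (real (i - 1) * H) * H) * (\<eta> \<bullet> regressor \<omega> (real (i - 1) * H)))
      + H * (H * (\<eta> \<bullet> regressor \<omega> (real (i - 1) * H))\<^sup>2))"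
    unfolding contrast_def periodic_drift_eq_inner inner_add_left
    by (intro sum.cong refl) (simp add: power2_eq_square algebra_simps)
  also have "\<dots> = contrast (periodic_drift \<omega>) n H x \<xi>
     - 2 * H * (\<eta> \<bullet> score \<omega> \<xi> n H x) + H * (H * (\<Sum>i=1..n. (\<eta> \<bullet> regressor \<omega> (real (i - 1) * H))\<^sup>2))"
    unfolding contrast_def score_def sum.distrib sum_subtractf sum_distrib_left[symmetric] inner_sum_right inner_scaleR_right ..
  finally show ?thesis .
qed

text \<open>Up to the bounded error of the design matrix, the contrast is \<open>H * T / 2\<close> times the squared distance
  to \<open>\<xi> + \<eta>\<close>, plus a constant. Comparing the minimizer with the competitor \<open>\<xi> + \<eta>\<close> therefore bounds
  their distance. Only membership of the competitor in \<open>S\<close> enters, so that minimizers on the boundary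
  need no separate treatment.\<close>

lemma minimizer_close_to_scaled_score:
  fixes \<xi> \<eta> :: "real ^ 2"
  assumes w: "\<omega> > 0" and H: "H > 0" and sin: "\<omega> * H / 2 \<le> sin (\<omega> * H)"
    and T: "8 / \<omega> \<le> real n * H"
    and min: "is_arg_min (contrast (periodic_drift \<omega>) n H x) (\<lambda>\<xi>. \<xi> \<in> S) \<xi>'"
    and \<eta>: "\<eta> = (2 / (real n * H)) *\<^sub>R score \<omega> \<xi> n H x" and S: "\<xi> + \<eta> \<in> S"
  shows "real n * H * (norm (\<xi>' - \<xi> - \<eta>))\<^sup>2 \<le> 12 / \<omega> * (norm \<eta>)\<^sup>2"
proof -
  define T where "T = real n * H"
  have T8: "8 / \<omega> \<le> T" and T0: "T > 0"
    using T w by (auto simp: T_def intro: less_le_trans[of 0 "8 / \<omega>"])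
  define \<zeta> where "\<zeta> = \<xi>' - \<xi>"
  define e where "e v = H * (\<Sum>i=1..n. (v \<bullet> regressor \<omega> (real (i - 1) * H))\<^sup>2) - T / 2 * (norm v)\<^sup>2" for v
  have e: "\<bar>e v\<bar> \<le> (norm v)\<^sup>2 / \<omega>" for v
    unfolding e_def T_def by (rule design_quadratic_form[OF w H sin])
  have B: "score \<omega> \<xi> n H x = (T / 2) *\<^sub>R \<eta>" using T0 by (simp add: \<eta> T_def[symmetric])
  have expand: "contrast (periodic_drift \<omega>) n H x (\<xi> + v) 
     = contrast (periodic_drift \<omega>) n H x \<xi> + H * (T / 2 * ((norm (v - \<eta>))\<^sup>2 - (norm \<eta>)\<^sup>2) + e v)" for v
  proof -
    have n: "(norm (v - \<eta>))\<^sup>2 = (norm v)\<^sup>2 - 2 * (v \<bullet> \<eta>) + (norm \<eta>)\<^sup>2"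
      by (simp add: power2_norm_eq_inner inner_diff_left inner_diff_right inner_commute)
    have sq: "T / 2 * ((norm (v - \<eta>))\<^sup>2 - (norm \<eta>)\<^sup>2) = T / 2 * (norm v)\<^sup>2 - T * (v \<bullet> \<eta>)"
      unfolding n by (simp add: algebra_simps)
    show ?thesis
      unfolding contrast_expansion B e_def sq by (simp add: algebra_simps)
  qed
  have "\<not> contrast (periodic_drift \<omega>) n H x (\<xi> + \<eta>) < contrast (periodic_drift \<omega>) n H x (\<xi> + \<zeta>)"
    using min S unfolding is_arg_min_def \<zeta>_def by auto
  then have "T / 2 * ((norm (\<zeta> - \<eta>))\<^sup>2 - (norm \<eta>)\<^sup>2) + e \<zeta> \<le> T / 2 * (0 - (norm \<eta>)\<^sup>2) + e \<eta>"
    unfolding expand using H by simp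
  then have 1: "T / 2 * (norm (\<zeta> - \<eta>))\<^sup>2 \<le> (norm \<eta>)\<^sup>2 / \<omega> + (norm \<zeta>)\<^sup>2 / \<omega>"
    using e[of \<zeta>] e[of \<eta>] by (simp add: algebra_simps abs_le_iff)
  have "(norm \<zeta>)\<^sup>2 \<le> 2 * (norm (\<zeta> - \<eta>))\<^sup>2 + 2 * (norm \<eta>)\<^sup>2"
  proof -
    have "norm \<zeta> \<le> norm (\<zeta> - \<eta>) + norm \<eta>" using norm_triangle_ineq[of "\<zeta> - \<eta>" \<eta>] by simp
    then have "(norm \<zeta>)\<^sup>2 \<le> (norm (\<zeta> - \<eta>) + norm \<eta>)\<^sup>2" by (intro power_mono) auto
    also have "\<dots> \<le> 2 * (norm (\<zeta> - \<eta>))\<^sup>2 + 2 * (norm \<eta>)\<^sup>2"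
      using sum_squares_bound[of "norm (\<zeta> - \<eta>)" "norm \<eta>"] by (simp add: power2_sum)
    finally show ?thesis .
  qed
  then have "(norm \<zeta>)\<^sup>2 / \<omega> \<le> (2 * (norm (\<zeta> - \<eta>))\<^sup>2 + 2 * (norm \<eta>)\<^sup>2) / \<omega>"
    using w by (intro divide_right_mono) auto
  then have "(norm \<zeta>)\<^sup>2 / \<omega> \<le> 2 * ((norm (\<zeta> - \<eta>))\<^sup>2 / \<omega>) + 2 * ((norm \<eta>)\<^sup>2 / \<omega>)"
    by (simp add: add_divide_distrib)
  with 1 have "T / 2 * (norm (\<zeta> - \<eta>))\<^sup>2 \<le> 3 * ((norm \<eta>)\<^sup>2 / \<omega>) + 2 * ((norm (\<zeta> - \<eta>))\<^sup>2 / \<omega>)"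
    by linarith
  then have 2: "T / 2 * (norm (\<zeta> - \<eta>))\<^sup>2 \<le> 3 / \<omega> * (norm \<eta>)\<^sup>2 + 2 / \<omega> * (norm (\<zeta> - \<eta>))\<^sup>2"
    by simp
  have "2 / \<omega> * (norm (\<zeta> - \<eta>))\<^sup>2 \<le> T / 4 * (norm (\<zeta> - \<eta>))\<^sup>2"
    using T8 by (intro mult_right_mono) auto
  with 2 have "T * (norm (\<zeta> - \<eta>))\<^sup>2 \<le> 12 / \<omega> * (norm \<eta>)\<^sup>2" by linarith
  then show ?thesis by (simp add: \<zeta>_def T_def)
qed

lemma summation_by_parts:
  fixes g :: "nat \<Rightarrow> 'a::real_vector" and z :: "nat \<Rightarrow> real"
  shows "(\<Sum>i=1..n. (z i - z (i - 1)) *\<^sub>R g (i - 1)) = z n *\<^sub>R g n - z 0 *\<^sub>R g 0 - (\<Sum>i=1..n. z i *\<^sub>R (g i - g (i - 1)))"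
  by (induction n) (auto simp: algebra_simps)

text \<open>Summation by parts moves the increments from the rough paths of \<open>Z\<close> to the smooth regressor. What
  remains, besides a weighted sum of values of \<open>Z\<close>, are two boundary terms, the second-order error of the
  regressor increments, and the error of replacing the integrated drift by a left Riemann sum.\<close>

lemma score_observed_process:
  fixes Z :: "real \<Rightarrow> 'w \<Rightarrow> real" and \<xi> :: "real ^ 2"
  assumes w: "\<omega> > 0" and H: "H > 0"
  shows "norm (score \<omega> \<xi> n H (\<lambda>t. observed_process (periodic_drift \<omega>) \<xi> Z t w)
             + H *\<^sub>R (\<Sum>i=1..n. Z (real i * H) w *\<^sub>R regressor_deriv \<omega> (real i * H)))
     \<le> \<bar>Z (real n * H) w\<bar> + \<bar>Z 0 w\<bar> + (\<omega> * H)\<^sup>2 * (\<Sum>i=1..n. \<bar>Z (real i * H) w\<bar>) + real n * (norm \<xi> * \<omega> * H\<^sup>2)"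
proof -
  define z where "z i = Z (real i * H) w" for i
  define g where "g i = regressor \<omega> (real i * H)" for i
  define g' where "g' i = regressor_deriv \<omega> (real i * H)" for i
  define \<rho> where "\<rho> i = (LBINT u:{0..real i * H}. periodic_drift \<omega> \<xi> u) - (LBINT u:{0..real (i - 1) * H}. periodic_drift \<omega> \<xi> u)
      - periodic_drift \<omega> \<xi> (real (i - 1) * H) * H" for i
  have step: "real i * H - real (i - 1) * H = H" if "i \<in> {1..n}" for i
    using that by (simp add: of_nat_diff algebra_simps)
  have \<rho>: "\<bar>\<rho> i\<bar> \<le> norm \<xi> * \<omega> * H\<^sup>2" if "i \<in> {1..n}" for i
    using drift_increment_error[of "real (i - 1) * H" "real i * H" \<omega> \<xi>] H w step[OF that] that
    unfolding \<rho>_def by simp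
  have "score \<omega> \<xi> n H (\<lambda>t. observed_process (periodic_drift \<omega>) \<xi> Z t w) = (\<Sum>i=1..n. (z i - z (i - 1)) *\<^sub>R g (i - 1) + \<rho> i *\<^sub>R g (i - 1))"
    unfolding score_def observed_process_def z_def g_def \<rho>_def
    by (intro sum.cong refl) (simp add: algebra_simps)
  also have "\<dots> = z n *\<^sub>R g n - z 0 *\<^sub>R g 0 - (\<Sum>i=1..n. z i *\<^sub>R (g i - g (i - 1))) + (\<Sum>i=1..n. \<rho> i *\<^sub>R g (i - 1))"
    by (simp only: sum.distrib summation_by_parts)
  finally have eq: "score \<omega> \<xi> n H (\<lambda>t. observed_process (periodic_drift \<omega>) \<xi> Z t w) + H *\<^sub>R (\<Sum>i=1..n. z i *\<^sub>R g' i)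
     = z n *\<^sub>R g n - z 0 *\<^sub>R g 0 - (\<Sum>i=1..n. z i *\<^sub>R (g i - g (i - 1) - H *\<^sub>R g' i)) + (\<Sum>i=1..n. \<rho> i *\<^sub>R g (i - 1))"
    by (simp add: scaleR_sum_right sum_subtractf scaleR_diff_right mult.commute)
  have a: "norm (z n *\<^sub>R g n) \<le> \<bar>z n\<bar>" "norm (z 0 *\<^sub>R g 0) \<le> \<bar>z 0\<bar>" by (simp_all add: g_def)
  have b: "norm (\<Sum>i=1..n. z i *\<^sub>R (g i - g (i - 1) - H *\<^sub>R g' i)) \<le> (\<omega> * H)\<^sup>2 * (\<Sum>i=1..n. \<bar>z i\<bar>)"
    unfolding sum_distrib_left
  proof (intro sum_norm_le)
    fix i assume i: "i \<in> {1..n}"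
    have "norm (g i - g (i - 1) - H *\<^sub>R g' i) \<le> (\<omega> * H)\<^sup>2"
      using regressor_linearization[of \<omega> "real i * H" "real (i - 1) * H"] unfolding step[OF i] g_def g'_def .
    then show "norm (z i *\<^sub>R (g i - g (i - 1) - H *\<^sub>R g' i)) \<le> (\<omega> * H)\<^sup>2 * \<bar>z i\<bar>"
      by (simp add: mult.commute mult_left_mono)
  qed
  have "norm (\<Sum>i=1..n. \<rho> i *\<^sub>R g (i - 1)) \<le> (\<Sum>i=1..n. norm \<xi> * \<omega> * H\<^sup>2)"
    by (intro sum_norm_le) (use \<rho> in \<open>simp add: g_def\<close>)
  then have c: "norm (\<Sum>i=1..n. \<rho> i *\<^sub>R g (i - 1)) \<le> real n * (norm \<xi> * \<omega> * H\<^sup>2)" by simp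
  have tri: "norm (p - q - r + s) \<le> norm p + norm q + norm r + norm s" for p q r s :: "real ^ 2"
    by (intro order.trans[OF norm_triangle_ineq] add_right_mono order.trans[OF norm_triangle_ineq4]) simp
  have z0: "z 0 = Z 0 w" by (simp add: z_def)
  show ?thesis
    using order.trans[OF tri[of "z n *\<^sub>R g n" "z 0 *\<^sub>R g 0"] add_mono[OF add_mono[OF add_mono[OF a] b] c]]
    unfolding eq[symmetric] unfolding z_def g'_def by simp
qed

section \<open>Asymptotic normality\<close>

text \<open>The leading term of \<open>sqrt T *\<^sub>R (\<xi>hat - \<xi>0)\<close>. Its projections are linear combinations of values of \<open>Z\<close>,
  hence exactly normal for every sample size.\<close>

definition gaussian_part :: "real \<Rightarrow> nat \<Rightarrow> real \<Rightarrow> (real \<Rightarrow> 'w \<Rightarrow> real) \<Rightarrow> 'w \<Rightarrow> real ^ 2" where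
  "gaussian_part \<omega> n H Z w =
     (- (2 * H / sqrt (real n * H))) *\<^sub>R (\<Sum>i=1..n. Z (real i * H) w *\<^sub>R regressor_deriv \<omega> (real i * H))"

text \<open>The bound of \<open>score_observed_process\<close>, rescaled by \<open>2 / sqrt T\<close>.\<close>

definition remainder_bound :: "real \<Rightarrow> real ^ 2 \<Rightarrow> nat \<Rightarrow> real \<Rightarrow> (real \<Rightarrow> 'w \<Rightarrow> real) \<Rightarrow> 'w \<Rightarrow> real" where
  "remainder_bound \<omega> \<xi> n H Z w = 2 / sqrt (real n * H) * (\<bar>Z (real n * H) w\<bar> + \<bar>Z 0 w\<bar>
     + (\<omega> * H)\<^sup>2 * (\<Sum>i=1..n. \<bar>Z (real i * H) w\<bar>) + real n * (norm \<xi> * \<omega> * H\<^sup>2))"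

lemma gaussian_part_measurable:
  assumes Z: "centered_stationary_gaussian_process M K Z" and H: "n \<ge> 1 \<Longrightarrow> H > 0"
  shows "gaussian_part \<omega> n H Z \<in> borel_measurable M"
proof -
  have "Z (real i * H) \<in> borel_measurable M" if "i \<in> {1..n}" for i
    using centered_stationary_gaussian_process_integrable(1)[OF Z, of "real i * H" 0] H that by simp
  then show ?thesis unfolding gaussian_part_def[abs_def]
    by (intro borel_measurable_scaleR borel_measurable_const borel_measurable_sum)
qed

lemma gaussian_part_projection:
  assumes Z: "centered_stationary_gaussian_process M K Z" and n: "n \<ge> 1" and H: "H > 0"
    and \<phi>: "\<And>t. s \<bullet> regressor_deriv \<omega> t = \<omega> * norm s * cos (\<omega> * t + \<phi>)"
  defines "V \<equiv> 4 * \<omega>\<^sup>2 * (norm s)\<^sup>2 * (H / real n * (\<Sum>i=1..n. \<Sum>j=1..n. 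
             cos (\<omega> * (real i * H) + \<phi>) * cos (\<omega> * (real j * H) + \<phi>) * K \<bar>real i * H - real j * H\<bar>))"
  shows "integrable M (\<lambda>w. (s \<bullet> gaussian_part \<omega> n H Z w)\<^sup>2)"
    and "(\<integral>w. (s \<bullet> gaussian_part \<omega> n H Z w)\<^sup>2 \<partial>M) = V"
    and "(\<integral>w. iexp (s \<bullet> gaussian_part \<omega> n H Z w) \<partial>M) = exp (- V / 2)"
proof -
  define q where "q = - (2 * H / sqrt (real n * H)) * (\<omega> * norm s)"
  define c where "c t = q * cos (\<omega> * t + \<phi>)" for t
  define J where "J = (\<lambda>i. real i * H) ` {1..n}"
  have inj: "inj_on (\<lambda>i. real i * H) {1..n}" using H by (auto simp: inj_on_def)
  have J: "finite J" "J \<subseteq> {0..}" using H by (auto simp: J_def)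
  have eq: "s \<bullet> gaussian_part \<omega> n H Z w = (\<Sum>t\<in>J. c t * Z t w)" for w
    unfolding J_def sum.reindex[OF inj] gaussian_part_def c_def q_def o_def
    by (simp add: inner_sum_right \<phi> sum_distrib_left sum_negf mult_ac)
  have q2: "q\<^sup>2 = 4 * \<omega>\<^sup>2 * (norm s)\<^sup>2 * (H / real n)"
    using H n by (simp add: q_def power_mult_distrib power_divide power2_eq_square)
  have "(\<Sum>t\<in>J. \<Sum>u\<in>J. c t * c u * K \<bar>t - u\<bar>)
     = (\<Sum>i=1..n. \<Sum>j=1..n. q\<^sup>2 * (cos (\<omega> * (real i * H) + \<phi>) * cos (\<omega> * (real j * H) + \<phi>) * K \<bar>real i * H - real j * H\<bar>))"
    unfolding J_def sum.reindex[OF inj] c_def o_def by (simp add: power2_eq_square mult_ac)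
  also have "\<dots> = V"
    unfolding V_def sum_distrib_left[symmetric] q2 by (simp add: mult.assoc)
  finally have V: "(\<Sum>t\<in>J. \<Sum>u\<in>J. c t * c u * K \<bar>t - u\<bar>) = V" .
  show "integrable M (\<lambda>w. (s \<bullet> gaussian_part \<omega> n H Z w)\<^sup>2)"
    and "(\<integral>w. (s \<bullet> gaussian_part \<omega> n H Z w)\<^sup>2 \<partial>M) = V"
    and "(\<integral>w. iexp (s \<bullet> gaussian_part \<omega> n H Z w) \<partial>M) = exp (- V / 2)"
    unfolding eq using gaussian_linear_combination[OF Z J, of c] unfolding V by auto
qed

lemma abs_le_one_plus_square: "\<bar>x\<bar> \<le> 1 + x\<^sup>2" for x :: real
  using sum_squares_bound[of "\<bar>x\<bar>" 1] by simp

lemma expectation_abs_le: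
  assumes "prob_space M" and Z: "centered_stationary_gaussian_process M K Z" and t: "t \<ge> 0"
  shows "integrable M (\<lambda>w. \<bar>Z t w\<bar>)" "(\<integral>w. \<bar>Z t w\<bar> \<partial>M) \<le> 1 + K 0"
proof -
  interpret prob_space M by fact
  note i = centered_stationary_gaussian_process_integrable[OF Z t t]
  show "integrable M (\<lambda>w. \<bar>Z t w\<bar>)" using i(2) by simp
  have "(\<integral>w. \<bar>Z t w\<bar> \<partial>M) \<le> (\<integral>w. 1 + Z t w * Z t w \<partial>M)"
    using i abs_le_one_plus_square by (intro integral_mono) (auto simp: power2_eq_square)
  also have "\<dots> = 1 + (\<integral>w. Z t w * Z t w \<partial>M)"
    using i by (simp add: prob_space)
  also have "(\<integral>w. Z t w * Z t w \<partial>M) = K 0"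
    using Z t by (simp add: centered_stationary_gaussian_process_def)
  finally show "(\<integral>w. \<bar>Z t w\<bar> \<partial>M) \<le> 1 + K 0" .
qed

text \<open>With \<open>T = real n * H\<close>, the boundary terms are of order \<open>1 / sqrt T\<close> and the discretization errors of
  order \<open>sqrt T * H\<close>.\<close>

lemma expectation_remainder_bound_le:
  assumes "prob_space M" and Z: "centered_stationary_gaussian_process M K Z" and H: "H > 0" and w: "\<omega> > 0"
  shows "integrable M (remainder_bound \<omega> \<xi> n H Z)"
    and "(\<integral>w. remainder_bound \<omega> \<xi> n H Z w \<partial>M) \<le> 2 / sqrt (real n * H) * (2 * (1 + K 0)) 
      + sqrt (real n * H * H * H) * (2 * (\<omega>\<^sup>2 * (1 + K 0) + norm \<xi> * \<omega>))"
proof -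
  interpret prob_space M by fact
  define T where "T = real n * H"
  have T: "T \<ge> 0" using H by (simp add: T_def)
  note E = expectation_abs_le[OF assms(1) Z]
  have t: "real i * H \<ge> 0" for i :: nat using H by simp
  note Et = E(1)[OF t] E(2)[OF t] E(1)[OF order.refl] E(2)[OF order.refl]
  show int: "integrable M (remainder_bound \<omega> \<xi> n H Z)"
    unfolding remainder_bound_def[abs_def] using Et
    by (intro integrable_mult_right Bochner_Integration.integrable_add Bochner_Integration.integrable_sum) auto
  have "(\<integral>w. remainder_bound \<omega> \<xi> n H Z w \<partial>M) = 2 / sqrt T * ((\<integral>w. \<bar>Z (real n * H) w\<bar> \<partial>M) + (\<integral>w. \<bar>Z 0 w\<bar> \<partial>M)
     + (\<omega> * H)\<^sup>2 * (\<Sum>i=1..n. (\<integral>w. \<bar>Z (real i * H) w\<bar> \<partial>M)) + real n * (norm \<xi> * \<omega> * H\<^sup>2))"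
    unfolding remainder_bound_def T_def[symmetric] using Et by (simp add: T_def prob_space)
  also have "\<dots> \<le> 2 / sqrt T * ((1 + K 0) + (1 + K 0) + (\<omega> * H)\<^sup>2 * (\<Sum>i=1..n. 1 + K 0) + real n * (norm \<xi> * \<omega> * H\<^sup>2))"
    using Et T by (intro mult_left_mono add_mono sum_mono order.refl) auto
  also have "\<dots> = 2 / sqrt T * (2 * (1 + K 0)) + T / sqrt T * (H * (2 * (\<omega>\<^sup>2 * (1 + K 0) + norm \<xi> * \<omega>)))"
    by (simp add: T_def power2_eq_square add_divide_distrib algebra_simps)
  also have "T / sqrt T = sqrt T" by (simp add: real_div_sqrt T)
  also have "sqrt T * (H * (2 * (\<omega>\<^sup>2 * (1 + K 0) + norm \<xi> * \<omega>))) = sqrt (T * H * H) * (2 * (\<omega>\<^sup>2 * (1 + K 0) + norm \<xi> * \<omega>))"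
    using H by (simp add: real_sqrt_mult)
  finally show "(\<integral>w. remainder_bound \<omega> \<xi> n H Z w \<partial>M) \<le> 2 / sqrt (real n * H) * (2 * (1 + K 0)) 
      + sqrt (real n * H * H * H) * (2 * (\<omega>\<^sup>2 * (1 + K 0) + norm \<xi> * \<omega>))"
    by (simp add: T_def)
qed

text \<open>The hypothesis \<open>small\<close> keeps the scaled score below \<open>\<delta>\<close> in norm, so that it moves \<open>\<xi>\<close> to an
  admissible competitor for the minimizer.\<close>

lemma estimator_close_to_gaussian_part:
  fixes Z :: "real \<Rightarrow> 'w \<Rightarrow> real" and \<xi> \<xi>' :: "real ^ 2"
  assumes w: "\<omega> > 0" and H: "H > 0" and n: "n \<ge> 1" and sin: "\<omega> * H / 2 \<le> sin (\<omega> * H)"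
    and T: "8 / \<omega> \<le> real n * H"
    and ball: "ball \<xi> \<delta> \<subseteq> S"
    and min: "is_arg_min (contrast (periodic_drift \<omega>) n H (\<lambda>t. observed_process (periodic_drift \<omega>) \<xi> Z t w))
       (\<lambda>\<xi>. \<xi> \<in> S) \<xi>'"
  defines "R \<equiv> remainder_bound \<omega> \<xi> n H Z w" and "W \<equiv> gaussian_part \<omega> n H Z w"
  assumes small: "(norm W + R) / sqrt (real n * H) < \<delta>"
  shows "norm (sqrt (real n * H) *\<^sub>R (\<xi>' - \<xi>) - W) \<le> R + sqrt (12 / \<omega>) * ((norm W + R) / sqrt (real n * H))"
proof -
  define T where "T = real n * H"
  have T0: "T > 0" using n H by (simp add: T_def)
  then have sT: "sqrt T > 0" "sqrt T * sqrt T = T" by simp_all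
  define B where "B = score \<omega> \<xi> n H (\<lambda>t. observed_process (periodic_drift \<omega>) \<xi> Z t w)"
  define \<eta> where "\<eta> = (2 / T) *\<^sub>R B"
  have T\<eta>: "sqrt T *\<^sub>R \<eta> = (2 / sqrt T) *\<^sub>R B"
    using sT by (simp add: \<eta>_def field_simps)
  have "sqrt T *\<^sub>R \<eta> - W = (2 / sqrt T) *\<^sub>R (B + H *\<^sub>R (\<Sum>i=1..n. Z (real i * H) w *\<^sub>R regressor_deriv \<omega> (real i * H)))"
    unfolding T\<eta> W_def gaussian_part_def T_def[symmetric] by (simp add: scaleR_add_right)
  then have "norm (sqrt T *\<^sub>R \<eta> - W) = 2 / sqrt T * norm (B + H *\<^sub>R (\<Sum>i=1..n. Z (real i * H) w *\<^sub>R regressor_deriv \<omega> (real i * H)))"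
    using sT by simp
  also have "\<dots> \<le> R"
    unfolding B_def R_def remainder_bound_def T_def using sT(1)[unfolded T_def]
    by (intro mult_left_mono score_observed_process[OF w H]) simp
  finally have close: "norm (sqrt T *\<^sub>R \<eta> - W) \<le> R" .
  have "sqrt T * norm \<eta> \<le> norm W + R"
    using norm_triangle_sub[of "sqrt T *\<^sub>R \<eta>" W] close sT by simp
  then have \<eta>_le: "norm \<eta> \<le> (norm W + R) / sqrt T"
    using sT by (simp add: field_simps)
  have "\<xi> + \<eta> \<in> S" using ball \<eta>_le small by (auto simp: dist_norm T_def)
  then have "T * (norm (\<xi>' - \<xi> - \<eta>))\<^sup>2 \<le> 12 / \<omega> * (norm \<eta>)\<^sup>2"
    using minimizer_close_to_scaled_score[OF w H sin T min, of \<eta> \<xi>] by (simp add: \<eta>_def B_def T_def)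
  then have "sqrt (T * (norm (\<xi>' - \<xi> - \<eta>))\<^sup>2) \<le> sqrt (12 / \<omega> * (norm \<eta>)\<^sup>2)" by simp
  then have "sqrt T * norm (\<xi>' - \<xi> - \<eta>) \<le> sqrt (12 / \<omega>) * norm \<eta>" by (simp only: real_sqrt_mult real_sqrt_abs abs_norm_cancel)
  also have "\<dots> \<le> sqrt (12 / \<omega>) * ((norm W + R) / sqrt T)" using w \<eta>_le by (intro mult_left_mono) auto
  finally have 1: "norm (sqrt T *\<^sub>R (\<xi>' - \<xi> - \<eta>)) \<le> sqrt (12 / \<omega>) * ((norm W + R) / sqrt T)"
    using sT by simp
  have "sqrt T *\<^sub>R (\<xi>' - \<xi>) - W = sqrt T *\<^sub>R (\<xi>' - \<xi> - \<eta>) + (sqrt T *\<^sub>R \<eta> - W)"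
    by (simp add: algebra_simps)
  then have "norm (sqrt T *\<^sub>R (\<xi>' - \<xi>) - W) \<le> norm (sqrt T *\<^sub>R (\<xi>' - \<xi> - \<eta>)) + norm (sqrt T *\<^sub>R \<eta> - W)"
    by (simp only: norm_triangle_ineq)
  with 1 close show ?thesis unfolding T_def by linarith
qed

lemma converges_in_distribution_cong_eventually:
  assumes conv: "converges_in_distribution M Y \<nu>"
    and ev: "\<forall>\<^sub>F n in sequentially. distr M borel (Y n) = distr M borel (Y' n)"
  shows "converges_in_distribution M Y' \<nu>"
  unfolding converges_in_distribution_def
proof (intro allI impI)
  fix f :: "'b \<Rightarrow> real" assume "continuous_on UNIV f \<and> bounded (range f)"
  then have "(\<lambda>n. \<integral>x. f x \<partial>distr M borel (Y n)) \<longlonglongrightarrow> (\<integral>x. f x \<partial>\<nu>)"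
    using conv unfolding converges_in_distribution_def by blast
  moreover have "\<forall>\<^sub>F n in sequentially. (\<integral>x. f x \<partial>distr M borel (Y n)) = (\<integral>x. f x \<partial>distr M borel (Y' n))"
    using ev by (rule eventually_mono) simp
  ultimately show "(\<lambda>n. \<integral>x. f x \<partial>distr M borel (Y' n)) \<longlonglongrightarrow> (\<integral>x. f x \<partial>\<nu>)"
    by (rule Lim_transform_eventually)
qed

text \<open>The two kernels enter only through monotonicity, continuity, integrability and the positivity of
  their cosine transform at \<open>\<omega>\<close>.\<close>

theorem asymptotic_normality_of_estimator:
  fixes M :: "'w measure" and Z :: "real \<Rightarrow> 'w \<Rightarrow> real" and K :: "real \<Rightarrow> real"
    and \<xi>hat :: "nat \<Rightarrow> 'w \<Rightarrow> real ^ 2" and \<xi>0 :: "real ^ 2"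
  assumes M: "prob_space M"
    and K: "\<And>u. u \<ge> 0 \<Longrightarrow> K u \<ge> 0" "\<And>u v. 0 \<le> u \<Longrightarrow> u \<le> v \<Longrightarrow> K v \<le> K u"
      "continuous_on {0..} K" "set_integrable lborel {0..} K"
    and C: "cos_transform K \<omega> > 0"
    and Z: "centered_stationary_gaussian_process M K Z"
    and w: "\<omega> > 0"
    and S: "\<xi>0 \<in> interior S"
    and h: "\<And>n. n \<ge> 1 \<Longrightarrow> h n > 0" "h \<longlonglongrightarrow> 0" "filterlim (\<lambda>n. real n * h n) at_top sequentially"
      "(\<lambda>n. (real n * h n) * h n) \<longlonglongrightarrow> 0"
    and meas: "\<And>n. n \<ge> 1 \<Longrightarrow> \<xi>hat n \<in> borel_measurable M"
    and min: "\<And>n w. n \<ge> 1 \<Longrightarrow> w \<in> space M \<Longrightarrow>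
           is_arg_min (contrast (periodic_drift \<omega>) n (h n) (\<lambda>t. observed_process (periodic_drift \<omega>) \<xi>0 Z t w))
             (\<lambda>\<xi>. \<xi> \<in> S) (\<xi>hat n w)"
  shows "converges_in_distribution M (\<lambda>n w. sqrt (real n * h n) *\<^sub>R (\<xi>hat n w - \<xi>0))
           (multivariate_normal 0 ((4 * \<omega>\<^sup>2 * cos_transform K \<omega>) *\<^sub>R mat 1))"
proof -
  interpret prob_space M by fact
  define \<sigma>2 where "\<sigma>2 = 4 * \<omega>\<^sup>2 * cos_transform K \<omega>"
  have \<sigma>2: "\<sigma>2 > 0" using C w by (simp add: \<sigma>2_def)
  define \<nu> where "\<nu> = multivariate_normal (0 :: real ^ 2) (\<sigma>2 *\<^sub>R mat 1)"
  note N = isotropic_normal_law[OF \<sigma>2, where 'n=2, folded \<nu>_def]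
  define T where "T n = real n * h n" for n
  have T: "filterlim T at_top sequentially" using h(3) by (simp add: T_def[abs_def])
  then have sT: "filterlim (\<lambda>n. sqrt (T n)) at_top sequentially" by (rule filterlim_compose[OF sqrt_at_top])
  have T_pos: "T n > 0" if "n \<ge> 1" for n using h(1)[OF that] that by (simp add: T_def)
  define W where "W n = gaussian_part \<omega> n (h n) Z" for n
  define R where "R n = remainder_bound \<omega> \<xi>0 n (h n) Z" for n
  \<comment> \<open>The estimator is only constrained for \<open>n \<ge> 1\<close>; a measurable value is put in at \<open>n = 0\<close>.\<close>
  define Y where "Y n w = (if n = 0 then 0 else sqrt (T n) *\<^sub>R (\<xi>hat n w - \<xi>0))" for n w
  have W_meas: "W n \<in> borel_measurable M" for n
    unfolding W_def by (rule gaussian_part_measurable[OF Z]) (rule h(1))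
  have Y_meas: "Y n \<in> borel_measurable M" for n
  proof (cases "n = 0")
    case False
    then have "\<xi>hat n \<in> borel_measurable M" by (intro meas) simp
    then show ?thesis using False unfolding Y_def[abs_def] by simp
  qed (simp add: Y_def[abs_def])
  note W_meas[measurable] Y_meas[measurable]

  define V where "V s n = (\<integral>w. (s \<bullet> W n w)\<^sup>2 \<partial>M)" for s n
  have projection: "(\<forall>n\<ge>1. integrable M (\<lambda>w. (s \<bullet> W n w)\<^sup>2) \<and> (\<integral>w. iexp (s \<bullet> W n w) \<partial>M) = exp (- V s n / 2))
      \<and> V s \<longlonglongrightarrow> \<sigma>2 * (norm s)\<^sup>2" for s
  proof -
    obtain \<psi> where "\<And>t. s \<bullet> regressor_deriv \<omega> t = - \<omega> * norm s * sin (\<omega> * t + \<psi>)"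
      using inner_regressor_polar[of s \<omega>] by blast
    then have \<phi>: "s \<bullet> regressor_deriv \<omega> t = \<omega> * norm s * cos (\<omega> * t + (\<psi> + pi / 2))" for t
      by (simp add: cos_add add.assoc[symmetric])
    define Q where "Q n = 4 * \<omega>\<^sup>2 * (norm s)\<^sup>2 * (h n / real n * (\<Sum>i=1..n. \<Sum>j=1..n.
             cos (\<omega> * (real i * h n) + (\<psi> + pi / 2)) * cos (\<omega> * (real j * h n) + (\<psi> + pi / 2)) * K \<bar>real i * h n - real j * h n\<bar>))" for n
    have P: "integrable M (\<lambda>w. (s \<bullet> W n w)\<^sup>2)" "V s n = Q n" "(\<integral>w. iexp (s \<bullet> W n w) \<partial>M) = exp (- Q n / 2)"
      if n: "n \<ge> 1" for n
      unfolding W_def V_def Q_def by (fact gaussian_part_projection[OF Z n h(1)[OF n] \<phi>])+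
    then have 1: "\<forall>n\<ge>1. integrable M (\<lambda>w. (s \<bullet> W n w)\<^sup>2) \<and> (\<integral>w. iexp (s \<bullet> W n w) \<partial>M) = exp (- V s n / 2)"
      by simp
    have "Q \<longlonglongrightarrow> 4 * \<omega>\<^sup>2 * (norm s)\<^sup>2 * cos_transform K \<omega>"
      unfolding cos_transform_def Q_def[abs_def]
      by (intro tendsto_mult_left quadratic_form_of_sampled_cosine_tendsto K h(1-3) w)
    moreover have "\<forall>\<^sub>F n in sequentially. Q n = V s n"
      using eventually_ge_at_top[of "1::nat"] by (rule eventually_mono) (simp add: P(2))
    ultimately have "V s \<longlonglongrightarrow> 4 * \<omega>\<^sup>2 * (norm s)\<^sup>2 * cos_transform K \<omega>"
      by (rule Lim_transform_eventually)
    then have "V s \<longlonglongrightarrow> \<sigma>2 * (norm s)\<^sup>2" by (simp add: \<sigma>2_def mult_ac)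
    with 1 show ?thesis by blast
  qed
  have proj: "integrable M (\<lambda>w. (s \<bullet> W n w)\<^sup>2)" "(\<integral>w. iexp (s \<bullet> W n w) \<partial>M) = exp (- V s n / 2)"
    if "n \<ge> 1" for s n
    using projection[of s] that by auto
  have V_lim: "V s \<longlonglongrightarrow> \<sigma>2 * (norm s)\<^sup>2" for s
    using projection[of s] by blast

  have char: "(\<lambda>n. \<integral>w. iexp (s \<bullet> W n w) \<partial>M) \<longlonglongrightarrow> (\<integral>x. iexp (s \<bullet> x) \<partial>\<nu>)" for s
  proof -
    have "(\<lambda>n. complex_of_real (exp (- V s n / 2))) \<longlonglongrightarrow> of_real (exp (- \<sigma>2 * (norm s)\<^sup>2 / 2))"
      unfolding minus_mult_left[symmetric] by (intro tendsto_intros V_lim) simp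
    moreover have "\<forall>\<^sub>F n in sequentially. complex_of_real (exp (- V s n / 2)) = (\<integral>w. iexp (s \<bullet> W n w) \<partial>M)"
      using eventually_ge_at_top[of "1::nat"] by (rule eventually_mono) (rule proj(2)[symmetric])
    ultimately show ?thesis unfolding N(3) by (rule Lim_transform_eventually)
  qed

  \<comment> \<open>The two second moments of the coordinates bound the first moment of the norm.\<close>
  define b where "b n = 2 + V (axis 1 1) n + V (axis 2 1) n" for n
  have W_bound: "integrable M (\<lambda>w. norm (W n w)) \<and> (n \<ge> 1 \<longrightarrow> (\<integral>w. norm (W n w) \<partial>M) \<le> b n)" for n
  proof (cases "n \<ge> 1")
    case True
    have le: "norm (W n w) \<le> 2 + (axis 1 1 \<bullet> W n w)\<^sup>2 + (axis 2 1 \<bullet> W n w)\<^sup>2" for w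
      using norm_le_l1_cart[of "W n w"] abs_le_one_plus_square[of "W n w $ 1"] abs_le_one_plus_square[of "W n w $ 2"]
      by (simp add: sum_2 inner_axis')
    have i2: "integrable M (\<lambda>w. 2 + (axis 1 1 \<bullet> W n w)\<^sup>2 + (axis 2 1 \<bullet> W n w)\<^sup>2)"
      using proj(1)[OF True] by simp
    have i: "integrable M (\<lambda>w. norm (W n w))"
      by (rule Bochner_Integration.integrable_bound[OF i2]) (use le in \<open>auto simp: order.trans[OF _ abs_ge_self]\<close>)
    have "(\<integral>w. norm (W n w) \<partial>M) \<le> (\<integral>w. 2 + (axis 1 1 \<bullet> W n w)\<^sup>2 + (axis 2 1 \<bullet> W n w)\<^sup>2 \<partial>M)"
      by (intro integral_mono i i2 le)
    also have "\<dots> = b n" using proj(1)[OF True] by (simp add: b_def V_def prob_space)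
    finally show ?thesis using i by simp
  qed (simp add: W_def gaussian_part_def)
  have b_lim: "b \<longlonglongrightarrow> 2 + \<sigma>2 * 1 + \<sigma>2 * 1"
    unfolding b_def using V_lim[of "axis 1 1"] V_lim[of "axis 2 1"] by (intro tendsto_intros) (simp_all add: norm_axis_1)

  have R_int: "integrable M (R n)" if "n \<ge> 1" for n
    unfolding R_def by (rule expectation_remainder_bound_le(1)[OF M Z h(1)[OF that] w])
  have R_nonneg: "R n w \<ge> 0" if "n \<ge> 1" for n w
    using h(1)[OF that] w unfolding R_def remainder_bound_def by (auto intro!: mult_nonneg_nonneg add_nonneg_nonneg sum_nonneg)
  have R_lim: "(\<lambda>n. \<integral>w. R n w \<partial>M) \<longlonglongrightarrow> 0"
  proof (rule Lim_null_comparison)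
    show "\<forall>\<^sub>F n in sequentially. norm (\<integral>w. R n w \<partial>M) \<le> 2 / sqrt (T n) * (2 * (1 + K 0)) 
      + sqrt (T n * h n * h n) * (2 * (\<omega>\<^sup>2 * (1 + K 0) + norm \<xi>0 * \<omega>))"
      using eventually_ge_at_top[of "1::nat"]
    proof (rule eventually_mono)
      fix n :: nat assume n: "1 \<le> n"
      have "(\<integral>w. R n w \<partial>M) \<ge> 0" using R_nonneg[OF n] by (rule Bochner_Integration.integral_nonneg)
      then show "norm (\<integral>w. R n w \<partial>M) \<le> 2 / sqrt (T n) * (2 * (1 + K 0)) 
          + sqrt (T n * h n * h n) * (2 * (\<omega>\<^sup>2 * (1 + K 0) + norm \<xi>0 * \<omega>))"
        using expectation_remainder_bound_le(2)[OF M Z h(1)[OF n] w, of \<xi>0 n] unfolding R_def T_def by simp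
    qed
    have "(\<lambda>n. 2 / sqrt (T n) * (2 * (1 + K 0)) + sqrt (T n * h n * h n) * (2 * (\<omega>\<^sup>2 * (1 + K 0) + norm \<xi>0 * \<omega>)))
      \<longlonglongrightarrow> 0 * (2 * (1 + K 0)) + sqrt (0 * 0) * (2 * (\<omega>\<^sup>2 * (1 + K 0) + norm \<xi>0 * \<omega>))"
      unfolding T_def
      by (intro tendsto_add tendsto_mult tendsto_const tendsto_real_sqrt h(2,4) real_tendsto_divide_at_top[OF tendsto_const] sT[unfolded T_def])
    then show "(\<lambda>n. 2 / sqrt (T n) * (2 * (1 + K 0)) + sqrt (T n * h n * h n) * (2 * (\<omega>\<^sup>2 * (1 + K 0) + norm \<xi>0 * \<omega>))) \<longlonglongrightarrow> 0"
      by simp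
  qed

  obtain \<delta> where \<delta>: "\<delta> > 0" "ball \<xi>0 \<delta> \<subseteq> S" using S by (auto simp: mem_interior)
  define c where "c = 1 + sqrt (12 / \<omega>)"
  have c: "c \<ge> 1" using w by (simp add: c_def)
  \<comment> \<open>\<open>E n\<close> tends to \<open>0\<close> in mean. It bounds both the distance of \<open>Y n\<close> to \<open>W n\<close> and the displacement of
    the competitor that has to stay below \<open>\<delta>\<close>; the summand \<open>1\<close> of \<open>c\<close> serves the latter.\<close>
  define E where "E n w = R n w + c * ((norm (W n w) + R n w) / sqrt (T n))" for n w
  have E_int: "integrable M (E n)" if "n \<ge> 1" for n
    unfolding E_def[abs_def] using R_int[OF that] W_bound[of n] by simp
  have E_lim: "(\<lambda>n. \<integral>w. E n w \<partial>M) \<longlonglongrightarrow> 0"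
  proof (rule Lim_null_comparison)
    show "\<forall>\<^sub>F n in sequentially. norm (\<integral>w. E n w \<partial>M) \<le> (\<integral>w. R n w \<partial>M) + c * ((b n + (\<integral>w. R n w \<partial>M)) / sqrt (T n))"
      using eventually_ge_at_top[of "1::nat"]
    proof (rule eventually_mono)
      fix n :: nat assume n: "1 \<le> n"
      have "(\<integral>w. E n w \<partial>M) \<ge> 0"
        unfolding E_def using R_nonneg[OF n] T_pos[OF n] c
        by (intro Bochner_Integration.integral_nonneg add_nonneg_nonneg mult_nonneg_nonneg divide_nonneg_nonneg) auto
      moreover have "(\<integral>w. E n w \<partial>M) = (\<integral>w. R n w \<partial>M) + c * (((\<integral>w. norm (W n w) \<partial>M) + (\<integral>w. R n w \<partial>M)) / sqrt (T n))"
        unfolding E_def using R_int[OF n] W_bound[of n] by simp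
      moreover have "\<dots> \<le> (\<integral>w. R n w \<partial>M) + c * ((b n + (\<integral>w. R n w \<partial>M)) / sqrt (T n))"
        using W_bound[of n] n T_pos[OF n] c by (intro add_left_mono mult_left_mono divide_right_mono add_right_mono) auto
      ultimately show "norm (\<integral>w. E n w \<partial>M) \<le> (\<integral>w. R n w \<partial>M) + c * ((b n + (\<integral>w. R n w \<partial>M)) / sqrt (T n))"
        by simp
    qed
    have "(\<lambda>n. (\<integral>w. R n w \<partial>M) + c * ((b n + (\<integral>w. R n w \<partial>M)) / sqrt (T n))) \<longlonglongrightarrow> 0 + c * 0"
      by (intro tendsto_add R_lim tendsto_mult tendsto_const real_tendsto_divide_at_top[OF tendsto_add[OF b_lim R_lim] sT])
    then show "(\<lambda>n. (\<integral>w. R n w \<partial>M) + c * ((b n + (\<integral>w. R n w \<partial>M)) / sqrt (T n))) \<longlonglongrightarrow> 0" by simp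
  qed

  have close: "(\<lambda>n. measure M {w\<in>space M. norm (Y n w - W n w) > e}) \<longlonglongrightarrow> 0" if e: "e > 0" for e
  proof (rule Lim_null_comparison)
    define m where "m = min e \<delta>"
    have m: "m > 0" using e \<delta> by (simp add: m_def)
    have "\<forall>\<^sub>F n in sequentially. 8 / \<omega> \<le> T n" using T by (simp add: filterlim_at_top)
    moreover have "\<forall>\<^sub>F n in sequentially. n \<ge> (1::nat)" by (rule eventually_ge_at_top)
    moreover have "\<forall>\<^sub>F n in sequentially. \<omega> * h n / 2 \<le> sin (\<omega> * h n)"
      by (rule sin_step_asymptotics[OF h(1,2) w])
    ultimately show "\<forall>\<^sub>F n in sequentially. norm (measure M {w\<in>space M. norm (Y n w - W n w) > e}) \<le> (\<integral>w. E n w \<partial>M) / m"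
    proof eventually_elim
      case (elim n)
      note n = elim(2)
      have "{w\<in>space M. norm (Y n w - W n w) > e} \<subseteq> {w\<in>space M. E n w \<ge> m}"
      proof safe
        fix w assume wM: "w \<in> space M" and far: "norm (Y n w - W n w) > e"
        show "E n w \<ge> m"
        proof (rule ccontr)
          assume "\<not> E n w \<ge> m"
          then have Es: "E n w < e" "E n w < \<delta>" by (simp_all add: m_def)
          define u where "u = (norm (W n w) + R n w) / sqrt (T n)"
          have u: "u \<ge> 0" unfolding u_def using R_nonneg[OF n] T_pos[OF n] by simp
          have En: "E n w = R n w + sqrt (12 / \<omega>) * u + u"
            unfolding E_def u_def[symmetric] c_def by (simp add: algebra_simps)
          have "sqrt (12 / \<omega>) * u \<ge> 0" using u w by simp
          then have "u < \<delta>" using Es(2) En R_nonneg[OF n, of w] by linarith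
          then have "norm (sqrt (T n) *\<^sub>R (\<xi>hat n w - \<xi>0) - W n w) \<le> R n w + sqrt (12 / \<omega>) * u"
            using estimator_close_to_gaussian_part[OF w h(1)[OF n] n elim(3) elim(1)[unfolded T_def] \<delta>(2) min[OF n wM]]
            unfolding u_def W_def R_def T_def by simp
          then have "norm (Y n w - W n w) \<le> E n w" using n u En by (simp add: Y_def)
          with Es far show False by simp
        qed
      qed
      then have "measure M {w\<in>space M. norm (Y n w - W n w) > e} \<le> measure M {w\<in>space M. E n w \<ge> m}"
        using borel_measurable_integrable[OF E_int[OF n]] by (intro finite_measure_mono) auto
      also have "\<dots> \<le> (\<integral>w. E n w \<partial>M) / m"
      proof (rule integral_Markov_inequality_measure[where A="{}", OF E_int[OF n]])
        show "AE w in M. 0 \<le> E n w"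
          unfolding E_def using R_nonneg[OF n] T_pos[OF n] c
          by (intro AE_I2 add_nonneg_nonneg mult_nonneg_nonneg divide_nonneg_nonneg) auto
      qed (use m in auto)
      finally show ?case by simp
    qed
    show "(\<lambda>n. (\<integral>w. E n w \<partial>M) / m) \<longlonglongrightarrow> 0"
      using tendsto_divide[OF E_lim tendsto_const, of m] m by simp
  qed

  have b_bdd: "\<forall>\<^sub>F n in sequentially. (\<integral>w. norm (W n w) \<partial>M) \<le> 3 + 2 * \<sigma>2"
  proof -
    have "\<forall>\<^sub>F n in sequentially. b n < 3 + 2 * \<sigma>2" using b_lim by (intro order_tendstoD(2)) auto
    moreover have "\<forall>\<^sub>F n in sequentially. n \<ge> (1::nat)" by (rule eventually_ge_at_top)
    ultimately show ?thesis by eventually_elim (use W_bound in \<open>force\<close>)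
  qed
  have "converges_in_distribution M Y \<nu>"
    by (rule converges_in_distribution_if_close[OF M Y_meas W_meas N(2,1) char _ b_bdd close])
      (use W_bound in auto)
  moreover have "\<forall>\<^sub>F n in sequentially. distr M borel (Y n) = distr M borel (\<lambda>w. sqrt (real n * h n) *\<^sub>R (\<xi>hat n w - \<xi>0))"
    using eventually_ge_at_top[of "1::nat"] by (rule eventually_mono) (simp add: Y_def[abs_def] T_def)
  ultimately have "converges_in_distribution M (\<lambda>n w. sqrt (real n * h n) *\<^sub>R (\<xi>hat n w - \<xi>0)) \<nu>"
    by (rule converges_in_distribution_cong_eventually)
  then show ?thesis unfolding \<nu>_def \<sigma>2_def .
qed

theorem proposition3p2:
  fixes M :: "'w measure"
    and Z :: "real \<Rightarrow> 'w \<Rightarrow> real"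
    and K :: "real \<Rightarrow> real"
    and a b \<omega> :: real
    and \<Xi> :: "(real ^ 2) set"
    and \<xi>0 :: "real ^ 2"
    and h :: "nat \<Rightarrow> real"
    and \<xi>hat :: "nat \<Rightarrow> 'w \<Rightarrow> real ^ 2"
  assumes "prob_space M"
    and "a > 0" and "b > 0"
    and "K = gaussian_kernel a b \<or> K = ou_kernel a b"
    and "centered_stationary_gaussian_process M K Z"
    and "\<omega> > 0"
    and "open \<Xi>" and "bounded \<Xi>" and "convex \<Xi>"
    and "\<xi>0 \<in> \<Xi>"
    and "\<And>n. n \<ge> 1 \<Longrightarrow> h n > 0"
    and "h \<longlonglongrightarrow> 0"
    and "filterlim (\<lambda>n. real n * h n) at_top sequentially"
    and "(\<lambda>n. (real n * h n) * h n) \<longlonglongrightarrow> 0"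
    and "\<And>n. n \<ge> 1 \<Longrightarrow> \<xi>hat n \<in> borel_measurable M"
    and "\<And>n w. n \<ge> 1 \<Longrightarrow> w \<in> space M \<Longrightarrow>
           is_arg_min
             (contrast (periodic_drift \<omega>) n (h n)
               (\<lambda>t. observed_process (periodic_drift \<omega>) \<xi>0 Z t w))
             (\<lambda>\<xi>. \<xi> \<in> closure \<Xi>) (\<xi>hat n w)"
  shows "converges_in_distribution M
           (\<lambda>n w. sqrt (real n * h n) *\<^sub>R (\<xi>hat n w - \<xi>0))
           (multivariate_normal 0 ((4 * \<omega>\<^sup>2 * cos_transform K \<omega>) *\<^sub>R mat 1))
         \<and> (K = ou_kernel a b \<longrightarrow> cos_transform K \<omega> = a * b / (b\<^sup>2 + \<omega>\<^sup>2))
         \<and> (K = gaussian_kernel a b \<longrightarrow>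
              cos_transform K \<omega> = a * sqrt (pi / (2 * b)) * exp (- \<omega>\<^sup>2 / (2 * b)))"
proof -
  note ou = ou_kernel_properties[OF assms(2,3)] and ga = gaussian_kernel_properties[OF assms(2,3)]
  have K: "\<And>u. u \<ge> 0 \<Longrightarrow> K u \<ge> 0" "\<And>u v. 0 \<le> u \<Longrightarrow> u \<le> v \<Longrightarrow> K v \<le> K u"
    "continuous_on {0..} K" "set_integrable lborel {0..} K"
    using assms(4) ou(1-4) ga(1-4) by auto
  have "a * b / (b\<^sup>2 + \<omega>\<^sup>2) > 0" using assms(2,3) by (simp add: add_pos_nonneg)
  moreover have "a * sqrt (pi / (2 * b)) * exp (- \<omega>\<^sup>2 / (2 * b)) > 0" using assms(2,3) by simp
  ultimately have C: "cos_transform K \<omega> > 0" using assms(4) ou(5) ga(5) by auto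
  have S: "\<xi>0 \<in> interior (closure \<Xi>)"
    using assms(7,10) interior_mono[OF closure_subset, of \<Xi>] by (auto simp: interior_open)
  have "converges_in_distribution M (\<lambda>n w. sqrt (real n * h n) *\<^sub>R (\<xi>hat n w - \<xi>0))
      (multivariate_normal 0 ((4 * \<omega>\<^sup>2 * cos_transform K \<omega>) *\<^sub>R mat 1))"
    by (rule asymptotic_normality_of_estimator[OF assms(1) K C assms(5,6) S assms(11-16)])
  then show ?thesis using ou(5) ga(5) by blast
qed

end
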